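(* Let $\mathcal{M}_1$ be a general rotational surface of elliptic type in $\mathbb{E}^4_2$ with plane meridian curve $m$, i.e. the Lorentz surface $$z(u,v)=\left(f(u)\cos\alpha v,\ f(u)\sin\alpha v,\ g(u)\cos\beta v,\ g(u)\sin\beta v\right),\quad u\in J,\ v\in[0,2\pi),$$ where $\alpha,\beta$ are positive constants and $f,g$ are smooth functions on $J$ with $\alpha^2f^2-\beta^2g^2<0$ and $f'^2-g'^2>0$. Then $\mathcal{M}_1$ has flat normal connection and non-parallel mean curvature vector field if and only if the meridian curve $m$ is determined by one of the following: (i) $f=c\,g$, where $c=const$, $1<c^2<\frac{\beta^2}{\alpha^2}$, and $\alpha<\beta$; in this case $\mathcal{M}_1$ is a developable ruled surface in $\mathbb{E}^4_2$; (ii) $\dfrac{ff'-gg'}{\sqrt{f'^2-g'^2}\,\sqrt{\beta^2g^2-\alpha^2f^2}}=C$, where $C=const$, $C\neq0$.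
   Context: $\mathbb{E}^4_2$ is $\mathbb{R}^4$ with the metric $dx_1^2+dx_2^2-dx_3^2-dx_4^2$. $J\subset\mathbb{R}$ is an interval. The meridian curve $m$ is the plane curve $u\mapsto(f(u),0,g(u),0)$. A surface in $\mathbb{E}^4_2$ is Lorentz if its induced metric has signature $(1,1)$; here the first fundamental form is $E=f'^2-g'^2>0$, $F=0$, $G=\alpha^2f^2-\beta^2g^2<0$. With $\sigma$ the second fundamental form and $D$ the normal connection, the mean curvature vector field is $H=\frac12\operatorname{tr}\sigma$; it is parallel if $DH=0$ identically, and non-parallel otherwise. The surface has flat normal connection if the curvature of the normal connection $\varkappa=\dfrac{\langle R^{\perp}(x,y)n_1,n_2\rangle}{\langle x,x\rangle\langle y,y\rangle-\langle x,y\rangle^2}$ vanishes identically, where $R^\perp$ is the curvature tensor of $D$, $x,y$ is a tangent frame and $n_1,n_2$ an orthonormal normal frame. A ruled surface (a surface swept out by straight lines) is developable if its normal space (equivalently, its tangent space) is constant along each fixed ruling. *)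

theory Defs
  imports "HOL-Analysis.Analysis"
begin

definition E42_inner :: "real^4 \<Rightarrow> real^4 \<Rightarrow> real" where
  "E42_inner x y = x$1 * y$1 + x$2 * y$2 - x$3 * y$3 - x$4 * y$4"

text \<open>
  Derivatives are taken within the set under consideration, so that intervals containing
  an endpoint are covered.  On nondegenerate intervals and on products of two such intervals
  these derivatives are unique, and at interior points they are the ordinary ones.
\<close>

definition dderiv ::
  "('a::real_normed_vector) set \<Rightarrow> ('a \<Rightarrow> 'b::real_normed_vector) \<Rightarrow> 'a \<Rightarrow> 'a \<Rightarrow> 'b" where
  "dderiv S F p a = frechet_derivative F (at p within S) a"

primrec Ck_on ::
  "nat \<Rightarrow> ('a::real_normed_vector) set \<Rightarrow> ('a \<Rightarrow> 'b::real_normed_vector) \<Rightarrow> bool" where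
  "Ck_on 0 S F \<longleftrightarrow> continuous_on S F"
| "Ck_on (Suc k) S F \<longleftrightarrow>
     (\<forall>p\<in>S. F differentiable (at p within S)) \<and> (\<forall>a. Ck_on k S (\<lambda>p. dderiv S F p a))"

definition smooth_on ::
  "('a::real_normed_vector) set \<Rightarrow> ('a \<Rightarrow> 'b::real_normed_vector) \<Rightarrow> bool" where
  "smooth_on S F \<longleftrightarrow> (\<forall>k. Ck_on k S F)"

text \<open>
  A parametrized surface is a map \<open>z\<close> on a parameter domain \<open>S\<close> in the plane.  Tangent vectors
  at \<open>z p\<close> are written \<open>dz(a)\<close> with \<open>a\<close> in the parameter plane.
\<close>

definition tangent_space :: "(real \<times> real) set \<Rightarrow> (real \<times> real \<Rightarrow> real^4) \<Rightarrow> real \<times> real \<Rightarrow> (real^4) set" where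
  "tangent_space S z p = range (dderiv S z p)"

definition normal_space :: "(real \<times> real) set \<Rightarrow> (real \<times> real \<Rightarrow> real^4) \<Rightarrow> real \<times> real \<Rightarrow> (real^4) set" where
  "normal_space S z p = {n. \<forall>x\<in>tangent_space S z p. E42_inner n x = 0}"

text \<open>
  The orthogonal projection onto the normal space; it is well defined wherever the induced
  metric is nondegenerate.
\<close>

definition normal_part ::
  "(real \<times> real) set \<Rightarrow> (real \<times> real \<Rightarrow> real^4) \<Rightarrow> real \<times> real \<Rightarrow> real^4 \<Rightarrow> real^4" where
  "normal_part S z p w = (THE n. n \<in> normal_space S z p \<and> w - n \<in> tangent_space S z p)"

definition first_form ::
  "(real \<times> real) set \<Rightarrow> (real \<times> real \<Rightarrow> real^4) \<Rightarrow> real \<times> real \<Rightarrow> real \<times> real \<Rightarrow> real \<times> real \<Rightarrow> real" where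
  "first_form S z p a b = E42_inner (dderiv S z p a) (dderiv S z p b)"

text \<open>Gauss formula: the normal part of the flat derivative of the tangent field \<open>dz(b)\<close> along \<open>a\<close>.\<close>

definition second_form ::
  "(real \<times> real) set \<Rightarrow> (real \<times> real \<Rightarrow> real^4) \<Rightarrow> real \<times> real \<Rightarrow> real \<times> real \<Rightarrow> real \<times> real \<Rightarrow> real^4" where
  "second_form S z p a b = normal_part S z p (dderiv S (\<lambda>q. dderiv S z q b) p a)"

text \<open>Half the trace of the second fundamental form with respect to the first one.\<close>

definition mean_curvature_vector ::
  "(real \<times> real) set \<Rightarrow> (real \<times> real \<Rightarrow> real^4) \<Rightarrow> real \<times> real \<Rightarrow> real^4" where
  "mean_curvature_vector S z p =
     (let e1 = (1, 0); e2 = (0, 1);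
          E = first_form S z p e1 e1; F = first_form S z p e1 e2; G = first_form S z p e2 e2
      in (1/2) *\<^sub>R ((1 / (E * G - F\<^sup>2)) *\<^sub>R
           (G *\<^sub>R second_form S z p e1 e1 - (2 * F) *\<^sub>R second_form S z p e1 e2
            + E *\<^sub>R second_form S z p e2 e2)))"

definition normal_connection ::
  "(real \<times> real) set \<Rightarrow> (real \<times> real \<Rightarrow> real^4) \<Rightarrow> real \<times> real \<Rightarrow> (real \<times> real \<Rightarrow> real^4)
     \<Rightarrow> real \<times> real \<Rightarrow> real^4" where
  "normal_connection S z a \<xi> p = normal_part S z p (dderiv S \<xi> p a)"

definition parallel_normal_field ::
  "(real \<times> real) set \<Rightarrow> (real \<times> real \<Rightarrow> real^4) \<Rightarrow> (real \<times> real \<Rightarrow> real^4) \<Rightarrow> bool" where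
  "parallel_normal_field S z \<xi> \<longleftrightarrow> (\<forall>p\<in>S. \<forall>a. normal_connection S z a \<xi> p = 0)"

text \<open>
  Here \<open>a\<close> and \<open>b\<close> are constant in the parameter plane, so that the tangent fields \<open>dz(a)\<close> and
  \<open>dz(b)\<close> commute and the bracket term of the curvature tensor vanishes.
\<close>

definition normal_curvature_tensor ::
  "(real \<times> real) set \<Rightarrow> (real \<times> real \<Rightarrow> real^4) \<Rightarrow> real \<times> real \<Rightarrow> real \<times> real
     \<Rightarrow> (real \<times> real \<Rightarrow> real^4) \<Rightarrow> real \<times> real \<Rightarrow> real^4" where
  "normal_curvature_tensor S z a b \<xi> p =
     normal_connection S z a (normal_connection S z b \<xi>) p
     - normal_connection S z b (normal_connection S z a \<xi>) p"

definition orthonormal_normal_frame ::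
  "(real \<times> real) set \<Rightarrow> (real \<times> real \<Rightarrow> real^4)
     \<Rightarrow> (real \<times> real \<Rightarrow> real^4) \<Rightarrow> (real \<times> real \<Rightarrow> real^4) \<Rightarrow> bool" where
  "orthonormal_normal_frame S z n1 n2 \<longleftrightarrow> smooth_on S n1 \<and> smooth_on S n2 \<and>
     (\<forall>p\<in>S. n1 p \<in> normal_space S z p \<and> n2 p \<in> normal_space S z p \<and>
        \<bar>E42_inner (n1 p) (n1 p)\<bar> = 1 \<and> \<bar>E42_inner (n2 p) (n2 p)\<bar> = 1 \<and>
        E42_inner (n1 p) (n2 p) = 0)"

definition normal_connection_curvature ::
  "(real \<times> real) set \<Rightarrow> (real \<times> real \<Rightarrow> real^4) \<Rightarrow> real \<times> real \<Rightarrow> real \<times> real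
     \<Rightarrow> (real \<times> real \<Rightarrow> real^4) \<Rightarrow> (real \<times> real \<Rightarrow> real^4) \<Rightarrow> real \<times> real \<Rightarrow> real" where
  "normal_connection_curvature S z a b n1 n2 p =
     E42_inner (normal_curvature_tensor S z a b n1 p) (n2 p) /
     (first_form S z p a a * first_form S z p b b - (first_form S z p a b)\<^sup>2)"

text \<open>
  Vanishing does not depend on the frames.  Quantifying over all of them loses nothing on the
  domains used here, which are products of two intervals and so carry global normal frames.
\<close>

definition flat_normal_connection ::
  "(real \<times> real) set \<Rightarrow> (real \<times> real \<Rightarrow> real^4) \<Rightarrow> bool" where
  "flat_normal_connection S z \<longleftrightarrow>
     (\<forall>n1 n2 a b. \<forall>p\<in>S. orthonormal_normal_frame S z n1 n2 \<longrightarrow>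
        dderiv S z p a \<noteq> dderiv S z p b \<longrightarrow> independent {dderiv S z p a, dderiv S z p b} \<longrightarrow>
        normal_connection_curvature S z a b n1 n2 p = 0)"

text \<open>
  The function \<open>\<tau>\<close> labels the rulings, \<open>s\<close> is the affine parameter on them, \<open>c\<close> is the
  directrix and \<open>r\<close> the field of directions.  Each ruling is mapped onto a nondegenerate
  piece of a straight line.  For an immersion \<open>z\<close> the representation forces \<open>(s, \<tau>)\<close> to be a
  change of parameters.
\<close>

definition ruling ::
  "(real \<times> real) set \<Rightarrow> (real \<times> real \<Rightarrow> real^4) \<Rightarrow> (real \<times> real \<Rightarrow> real) \<Rightarrow> bool" where
  "ruling S z \<tau> \<longleftrightarrow> smooth_on S \<tau> \<and>
     (\<exists>s c r. smooth_on S s \<and> smooth_on (\<tau> ` S) c \<and> smooth_on (\<tau> ` S) r \<and>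
        inj_on (\<lambda>p. (s p, \<tau> p)) S \<and>
        (\<forall>p\<in>S. z p = c (\<tau> p) + s p *\<^sub>R r (\<tau> p)) \<and>
        (\<forall>t\<in>\<tau> ` S. r t \<noteq> (0::real^4) \<and>
           is_interval (s ` {p\<in>S. \<tau> p = t}) \<and> interior (s ` {p\<in>S. \<tau> p = t}) \<noteq> {}))"

definition developable_ruled_surface ::
  "(real \<times> real) set \<Rightarrow> (real \<times> real \<Rightarrow> real^4) \<Rightarrow> bool" where
  "developable_ruled_surface S z \<longleftrightarrow>
     (\<exists>\<tau>. ruling S z \<tau> \<and>
        (\<forall>p\<in>S. \<forall>q\<in>S. \<tau> p = \<tau> q \<longrightarrow> normal_space S z p = normal_space S z q))"

definition rotational_surface ::
  "real \<Rightarrow> real \<Rightarrow> (real \<Rightarrow> real) \<Rightarrow> (real \<Rightarrow> real) \<Rightarrow> real \<times> real \<Rightarrow> real^4" where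
  "rotational_surface \<alpha> \<beta> f g = (\<lambda>(u, v).
     vector [f u * cos (\<alpha> * v), f u * sin (\<alpha> * v), g u * cos (\<beta> * v), g u * sin (\<beta> * v)])"

end

theory Submission
  imports Defs
begin

text \<open>
  The surface is an orbit of its meridian under a one-parameter group of isometries, so in the
  frame that rotates with it all geometric quantities depend on \<open>u\<close> alone.  Write
  \<open>E = f'\<^sup>2 - g'\<^sup>2\<close> and \<open>W = \<beta>\<^sup>2 g\<^sup>2 - \<alpha>\<^sup>2 f\<^sup>2\<close>.  Rotating the vectors \<open>(g', 0, f', 0) / sqrt E\<close> and
  \<open>(0, \<beta> g, 0, \<alpha> f) / sqrt W\<close> gives a global orthonormal normal frame \<open>\<nu>\<^sub>1, \<nu>\<^sub>2\<close> with
  \<open>D \<nu>\<^sub>1 = - \<kappa> dv \<nu>\<^sub>2\<close> and \<open>D \<nu>\<^sub>2 = - \<kappa> dv \<nu>\<^sub>1\<close>, where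
  \<open>\<kappa> = \<alpha> \<beta> (f f' - g g') / (sqrt E sqrt W)\<close> (lemma \<open>normal_connection_frame\<close>).  The curvature of
  this connection is given by \<open>d\<kappa> \<and> dv\<close>, so the normal connection is flat if and only if \<open>\<kappa>\<close> is
  constant (\<open>flat_iff_\<kappa>_constant\<close>).  For arbitrary normal fields this uses the symmetry of
  second derivatives on a domain which contains part of its boundary (\<open>dderiv_commute\<close>).

  The mean curvature vector is \<open>H = h \<nu>\<^sub>1\<close> for a function \<open>h\<close> of \<open>u\<close> (\<open>mean_curvature\<close>), so
  \<open>D H = h' du \<nu>\<^sub>1 - \<kappa> h dv \<nu>\<^sub>2\<close>.
  If \<open>\<kappa> = 0\<close>, then \<open>f\<^sup>2 - g\<^sup>2\<close> is constant and \<open>H\<close> is a constant multiple of the position vector,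
  hence parallel (\<open>\<kappa>_zero_parallel\<close>).
  If \<open>\<kappa>\<close> is a nonzero constant, a parallel \<open>H\<close> would have to vanish, but then \<open>\<kappa>' = 0\<close> and \<open>h = 0\<close>
  together contradict the signs of \<open>E\<close> and \<open>W\<close> (\<open>\<kappa>_constant_not_minimal\<close>).
  So a flat normal connection and a non-parallel \<open>H\<close> occur together exactly when \<open>\<kappa>\<close> is a nonzero
  constant.  The lines \<open>f = c g\<close> have this property (\<open>linear_meridian_\<kappa>\<close>).  Their rotated copies
  are the rulings of the surface, and the tangent plane, spanned by a ruling and the derivative
  of its direction, is constant along them (\<open>linear_meridian_developable\<close>).
\<close>

section \<open>Smooth maps on sets with unique derivatives\<close>

text \<open>
  Derivatives within a set see a map only through its values there, so maps that agree on the
  set are interchangeable in every construction below.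
\<close>

lemma dderiv_cong:
  assumes "\<And>q. q \<in> S \<Longrightarrow> F q = G q" and "p \<in> S"
  shows "dderiv S F p = dderiv S G p"
proof -
  have "(F has_derivative D) (at p within S) \<longleftrightarrow> (G has_derivative D) (at p within S)" for D
    using has_derivative_transform[of p S F G] has_derivative_transform[of p S G F] assms by metis
  then show ?thesis
    by (auto simp: dderiv_def frechet_derivative_def fun_eq_iff)
qed

lemma Ck_on_cong:
  assumes "\<And>q. q \<in> S \<Longrightarrow> F q = G q" and "Ck_on k S F"
  shows "Ck_on k S G"
  using assms
proof (induction k arbitrary: F G)
  case 0
  then show ?case
    using continuous_on_eq[of S F G] by simp
next
  case (Suc k)
  have "G differentiable (at p within S)" if "p \<in> S" for p
    using Suc.prems that has_derivative_transform[of p S G F]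
    unfolding differentiable_def Ck_on.simps by metis
  moreover have "Ck_on k S (\<lambda>p. dderiv S G p a)" for a
    by (rule Suc.IH[of "\<lambda>p. dderiv S F p a"])
       (use Suc.prems in \<open>simp_all add: dderiv_cong[of S F G]\<close>)
  ultimately show ?case
    by simp
qed

lemma Ck_on_has_derivative:
  assumes "Ck_on (Suc k) S F" and "p \<in> S"
  shows "(F has_derivative dderiv S F p) (at p within S)"
  using assms by (simp add: frechet_derivative_works[symmetric] dderiv_def [abs_def] eta_contract_eq)

lemma Ck_on_continuous: "Ck_on k S F \<Longrightarrow> continuous_on S F"
  by (cases k) (auto simp: continuous_on_eq_continuous_within differentiable_imp_continuous_within)

lemma Ck_on_SucD: "Ck_on (Suc k) S F \<Longrightarrow> Ck_on k S F"
proof (induction k arbitrary: F)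
  case 0
  then show ?case
    by (metis Ck_on_continuous Ck_on.simps(1))
next
  case (Suc k)
  then show ?case
    by (metis Ck_on.simps(2))
qed

lemma smooth_on_has_derivative:
  "smooth_on S F \<Longrightarrow> p \<in> S \<Longrightarrow> (F has_derivative dderiv S F p) (at p within S)"
  unfolding smooth_on_def using Ck_on_has_derivative[of 0 S F] by blast

lemma smooth_on_continuous: "smooth_on S F \<Longrightarrow> continuous_on S F"
  unfolding smooth_on_def by (metis Ck_on.simps(1))

lemma smooth_on_dderiv: "smooth_on S F \<Longrightarrow> smooth_on S (\<lambda>p. dderiv S F p a)"
  unfolding smooth_on_def by (metis Ck_on.simps(2))

lemma smooth_on_cong:
  "(\<And>q. q \<in> S \<Longrightarrow> F q = G q) \<Longrightarrow> smooth_on S F \<Longrightarrow> smooth_on S G"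
  unfolding smooth_on_def using Ck_on_cong by blast

text \<open>
  The parameter domain is not open, since the angle runs over a half-open interval and the
  interval of the meridian may contain its endpoints.  Derivatives within a set are still unique
  when each of its points can be approached inside the set along every coordinate direction,
  possibly from one side only.
\<close>

locale approachable =
  fixes S :: "'a::euclidean_space set"
  assumes approach: "p \<in> S \<Longrightarrow> i \<in> Basis \<Longrightarrow> e > 0 \<Longrightarrow> \<exists>d. 0 < \<bar>d\<bar> \<and> \<bar>d\<bar> < e \<and> p + d *\<^sub>R i \<in> S"
begin

lemma dderiv_eqI:
  assumes "(F has_derivative D) (at p within S)" and "p \<in> S"
  shows "dderiv S F p = D"
proof -
  have "(F has_derivative dderiv S F p) (at p within S)"
    using assms(1) by (auto simp: dderiv_def[abs_def] frechet_derivative_works[symmetric] differentiable_def)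
  then show ?thesis
    using frechet_derivative_unique_within[of F _ p S D] assms approach by blast
qed

lemma Ck_on_SucI:
  assumes "\<And>p. p \<in> S \<Longrightarrow> (F has_derivative F' p) (at p within S)"
    and "\<And>a. Ck_on k S (\<lambda>p. F' p a)"
  shows "Ck_on (Suc k) S F"
proof -
  have "Ck_on k S (\<lambda>p. dderiv S F p a)" for a
    by (rule Ck_on_cong[OF _ assms(2)[of a]]) (simp add: dderiv_eqI[OF assms(1)])
  then show ?thesis
    using assms(1) by (auto simp: differentiable_def)
qed

lemma Ck_on_const: "Ck_on k S (\<lambda>_. c)"
proof (induction k arbitrary: c)
  case (Suc k)
  then show ?case
    by (intro Ck_on_SucI[OF has_derivative_const])
qed simp

lemma Ck_on_linear:
  assumes "bounded_linear L" "Ck_on k S F"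
  shows "Ck_on k S (\<lambda>p. L (F p))"
  using assms(2)
proof (induction k arbitrary: F)
  case 0
  then show ?case
    using bounded_linear.continuous_on[OF assms(1)] by simp
next
  case (Suc k)
  show ?case
    by (rule Ck_on_SucI[OF bounded_linear.has_derivative[OF assms(1) Ck_on_has_derivative[OF Suc.prems]]])
       (use Suc in auto)
qed

lemma Ck_on_add:
  assumes "Ck_on k S F" "Ck_on k S G"
  shows "Ck_on k S (\<lambda>p. F p + G p)"
  using assms
proof (induction k arbitrary: F G)
  case 0
  then show ?case
    by (simp add: continuous_on_add)
next
  case (Suc k)
  show ?case
    by (rule Ck_on_SucI[OF has_derivative_add[OF Ck_on_has_derivative Ck_on_has_derivative]])
       (use Suc in auto)
qed

lemma Ck_on_bilinear:
  assumes "bounded_bilinear B" "Ck_on k S F" "Ck_on k S G"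
  shows "Ck_on k S (\<lambda>p. B (F p) (G p))"
  using assms(2,3)
proof (induction k arbitrary: F G)
  case 0
  then show ?case
    using bounded_bilinear.continuous_on[OF assms(1)] by simp
next
  case (Suc k)
  show ?case
  proof (rule Ck_on_SucI[OF bounded_bilinear.FDERIV[OF assms(1) Ck_on_has_derivative Ck_on_has_derivative]])
    show "Ck_on k S (\<lambda>p. B (F p) (dderiv S G p a) + B (dderiv S F p a) (G p))" for a
    proof -
      have "Ck_on k S F" "Ck_on k S G" "Ck_on k S (\<lambda>p. dderiv S F p a)" "Ck_on k S (\<lambda>p. dderiv S G p a)"
        using Suc.prems Ck_on_SucD by auto
      then show ?thesis
        by (intro Ck_on_add Suc.IH[of F] Suc.IH[of _ G])
    qed
  qed (use Suc.prems in auto)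
qed

text \<open>
  Closure under composition with a function of one real variable, given as the first member of
  a sequence each of whose terms is the derivative of its predecessor; this covers sine, cosine
  and real powers, whose iterated derivatives are known in closed form.
\<close>

lemma Ck_on_compose_real:
  fixes \<phi> :: "nat \<Rightarrow> real \<Rightarrow> real"
  assumes "\<And>n x. x \<in> T \<Longrightarrow> (\<phi> n has_real_derivative \<phi> (Suc n) x) (at x)"
    and "\<And>p. p \<in> S \<Longrightarrow> F p \<in> T" and "Ck_on k S F"
  shows "Ck_on k S (\<lambda>p. \<phi> n (F p))"
  using assms(3)
proof (induction k arbitrary: n)
  case 0
  have "continuous_on T (\<phi> n)"
    using assms(1) by (meson DERIV_isCont continuous_at_imp_continuous_on)
  then show ?case
    using 0 assms(2) by (auto intro: continuous_on_compose2)
next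
  case (Suc k)
  show ?case
  proof (rule Ck_on_SucI)
    show "((\<lambda>p. \<phi> n (F p)) has_derivative (\<lambda>a. \<phi> (Suc n) (F p) * dderiv S F p a)) (at p within S)"
      if "p \<in> S" for p
      using has_derivative_compose[OF Ck_on_has_derivative[OF Suc.prems that]
          assms(1)[OF assms(2)[OF that], unfolded has_field_derivative_def]] .
    show "Ck_on k S (\<lambda>p. \<phi> (Suc n) (F p) * dderiv S F p a)" for a
      using Suc.prems by (intro Ck_on_bilinear[OF bounded_bilinear_mult Suc.IH[OF Ck_on_SucD]]) auto
  qed
qed

lemma smooth_on_const: "smooth_on S (\<lambda>_. c)"
  by (simp add: smooth_on_def Ck_on_const)

lemma smooth_on_linear: "bounded_linear L \<Longrightarrow> smooth_on S F \<Longrightarrow> smooth_on S (\<lambda>p. L (F p))"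
  using Ck_on_linear[of L _ F] unfolding smooth_on_def by blast

lemma smooth_on_linear_map: "bounded_linear L \<Longrightarrow> smooth_on S L"
proof -
  assume L: "bounded_linear L"
  have "Ck_on k S L" for k
  proof (cases k)
    case 0
    then show ?thesis
      by (simp add: L linear_continuous_on)
  next
    case (Suc m)
    have "Ck_on (Suc m) S L"
      by (rule Ck_on_SucI[OF bounded_linear_imp_has_derivative[OF L]]) (rule Ck_on_const)
    then show ?thesis
      by (simp only: Suc)
  qed
  then show ?thesis
    unfolding smooth_on_def by blast
qed

lemma smooth_on_add: "smooth_on S F \<Longrightarrow> smooth_on S G \<Longrightarrow> smooth_on S (\<lambda>p. F p + G p)"
  using Ck_on_add[of _ F G] unfolding smooth_on_def by blast

lemma smooth_on_bilinear:
  "bounded_bilinear B \<Longrightarrow> smooth_on S F \<Longrightarrow> smooth_on S G \<Longrightarrow> smooth_on S (\<lambda>p. B (F p) (G p))"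
  using Ck_on_bilinear[of B _ F G] unfolding smooth_on_def by blast

lemmas smooth_on_mult [intro] = smooth_on_bilinear[OF bounded_bilinear_mult]

lemmas smooth_on_scaleR [intro] = smooth_on_bilinear[OF bounded_bilinear_scaleR]

lemma smooth_on_minus: "smooth_on S F \<Longrightarrow> smooth_on S (\<lambda>p. - F p)"
  using smooth_on_linear[OF bounded_linear_minus[OF bounded_linear_ident]] .

lemma smooth_on_diff: "smooth_on S F \<Longrightarrow> smooth_on S G \<Longrightarrow> smooth_on S (\<lambda>p. F p - G p)"
  using smooth_on_add[of F "\<lambda>p. - G p"] smooth_on_minus[of G] by simp

lemma smooth_on_compose_real:
  fixes \<phi> :: "nat \<Rightarrow> real \<Rightarrow> real"
  assumes "\<And>n x. x \<in> T \<Longrightarrow> (\<phi> n has_real_derivative \<phi> (Suc n) x) (at x)"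
    and "\<And>p. p \<in> S \<Longrightarrow> F p \<in> T" and "smooth_on S F"
  shows "smooth_on S (\<lambda>p. \<phi> n (F p))"
  using assms(3) Ck_on_compose_real[of T \<phi> F, OF assms(1,2)] unfolding smooth_on_def by blast

lemma smooth_on_sin: "smooth_on S F \<Longrightarrow> smooth_on S (\<lambda>p. sin (F p :: real))"
  and smooth_on_cos: "smooth_on S F \<Longrightarrow> smooth_on S (\<lambda>p. cos (F p :: real))"
proof -
  define \<phi> :: "nat \<Rightarrow> real \<Rightarrow> real" where "\<phi> n x = sin (x + real n * (pi / 2))" for n x
  have \<phi>: "(\<phi> n has_real_derivative \<phi> (Suc n) x) (at x)" for n x
  proof -
    have "\<phi> (Suc n) x = sin (x + real n * (pi / 2) + pi / 2)"
      by (simp add: \<phi>_def algebra_simps add_divide_distrib)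
    also have "\<dots> = cos (x + real n * (pi / 2))"
      by (subst sin_add) simp
    finally show ?thesis
      unfolding \<phi>_def[of n, abs_def] by (auto intro!: derivative_eq_intros)
  qed
  show "smooth_on S F \<Longrightarrow> smooth_on S (\<lambda>p. sin (F p))"
    using smooth_on_compose_real[of UNIV \<phi>, where n = 0] \<phi> by (simp add: \<phi>_def)
  show "smooth_on S F \<Longrightarrow> smooth_on S (\<lambda>p. cos (F p))"
    using smooth_on_compose_real[of UNIV \<phi>, where n = 1] \<phi> by (simp add: \<phi>_def sin_add)
qed

lemma smooth_on_powr:
  assumes "smooth_on S F" and "\<And>p. p \<in> S \<Longrightarrow> F p > (0::real)"
  shows "smooth_on S (\<lambda>p. F p powr r)"
proof -
  define \<phi> :: "nat \<Rightarrow> real \<Rightarrow> real"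
    where "\<phi> n x = (\<Prod>k<n. r - real k) * x powr (r - real n)" for n x
  have "(\<phi> n has_real_derivative \<phi> (Suc n) x) (at x)" if "x \<in> {0<..}" for n x
    unfolding \<phi>_def using that
    by (auto intro!: derivative_eq_intros simp: algebra_simps)
  then show ?thesis
    using smooth_on_compose_real[of "{0<..}" \<phi>, where n = 0] assms by (simp add: \<phi>_def)
qed

lemma smooth_on_inverse_sqrt:
  assumes "smooth_on S F" and "\<And>p. p \<in> S \<Longrightarrow> F p > (0::real)"
  shows "smooth_on S (\<lambda>p. 1 / sqrt (F p))"
  by (rule smooth_on_cong[OF _ smooth_on_powr[OF assms, of "-1/2"]])
     (simp_all add: powr_minus_divide powr_half_sqrt[symmetric] assms(2) less_imp_le)

lemma smooth_on_inverse:
  assumes "smooth_on S F" and "\<And>p. p \<in> S \<Longrightarrow> F p > (0::real)"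
  shows "smooth_on S (\<lambda>p. 1 / F p)"
  by (rule smooth_on_cong[OF _ smooth_on_powr[OF assms, of "-1"]])
     (use assms(2) in \<open>force simp: powr_minus_divide powr_one\<close>)+

lemma smooth_on_vec:
  fixes F :: "'a \<Rightarrow> real^4"
  assumes "\<And>i. smooth_on S (\<lambda>p. F p $ i)"
  shows "smooth_on S F"
proof -
  have "F p $ 1 *\<^sub>R axis 1 1 + F p $ 2 *\<^sub>R axis 2 1 + F p $ 3 *\<^sub>R axis 3 1
      + F p $ 4 *\<^sub>R axis 4 1 = F p" for p
    by (simp add: vec_eq_iff forall_4 axis_def)
  then show ?thesis
    by (rule smooth_on_cong) (intro smooth_on_add smooth_on_scaleR smooth_on_const assms)
qed

end

section \<open>Mixed partial derivatives on products of intervals\<close>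

lemma approachable_interval:
  fixes J :: "real set"
  assumes "is_interval J" "interior J \<noteq> {}"
  shows "approachable J"
proof
  fix p e :: real and i :: real
  assume "p \<in> J" "i \<in> Basis" "e > 0"
  obtain x r where x: "r > 0" "ball x r \<subseteq> J"
    using assms(2) by (meson all_not_in_conv mem_interior)
  obtain y where y: "y \<in> J" "y \<noteq> p"
  proof (cases "x = p")
    case True
    then show ?thesis
      using x that[of "x + r/2"] by (auto simp: subset_eq dist_real_def)
  next
    case False
    then show ?thesis
      using x that[of x] by (meson centre_in_ball subsetD)
  qed
  define d where "d = (if \<bar>y - p\<bar> < e then y - p else sgn (y - p) * (e / 2))"
  have "p + d \<in> closed_segment p y"
    using \<open>e > 0\<close> y(2) by (auto simp: d_def closed_segment_eq_real_ivl sgn_if split: if_splits)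
  then have "p + d \<in> J"
    using assms(1) \<open>p \<in> J\<close> y(1) by (meson closed_segment_subset is_interval_convex subsetD)
  moreover have "0 < \<bar>d\<bar>" "\<bar>d\<bar> < e"
    using \<open>e > 0\<close> y(2) by (auto simp: d_def abs_mult sgn_if)
  ultimately show "\<exists>d. 0 < \<bar>d\<bar> \<and> \<bar>d\<bar> < e \<and> p + d *\<^sub>R i \<in> J"
    using \<open>i \<in> Basis\<close> by auto
qed

lemma approachable_Times:
  fixes J :: "'a::euclidean_space set" and K :: "'b::euclidean_space set"
  assumes "approachable J" "approachable K"
  shows "approachable (J \<times> K)"
proof
  fix p and e :: real and i :: "'a \<times> 'b"
  assume p: "p \<in> J \<times> K" and i: "i \<in> Basis" and e: "e > 0"
  from i consider j where "j \<in> Basis" "i = (j, 0)" | j where "j \<in> Basis" "i = (0, j)"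
    by (auto simp: Basis_prod_def)
  then show "\<exists>d. 0 < \<bar>d\<bar> \<and> \<bar>d\<bar> < e \<and> p + d *\<^sub>R i \<in> J \<times> K"
  proof cases
    case 1
    then show ?thesis
      using approachable.approach[OF assms(1), of "fst p" j e] p e by (cases p) auto
  next
    case 2
    then show ?thesis
      using approachable.approach[OF assms(2), of "snd p" j e] p e by (cases p) auto
  qed
qed

text \<open>
  Two applications of the mean value theorem express the second difference of \<open>F\<close> over a
  rectangle through a mixed derivative at one of its points.
\<close>

lemma second_difference_mean_value:
  fixes F A M :: "real \<Rightarrow> real \<Rightarrow> real"
  assumes "a \<le> b" "c \<le> d"
    and F: "\<And>u v. u \<in> {a..b} \<Longrightarrow> v \<in> {c..d} \<Longrightarrow> ((\<lambda>u. F u v) has_real_derivative A u v) (at u within {a..b})"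
    and A: "\<And>u v. u \<in> {a..b} \<Longrightarrow> v \<in> {c..d} \<Longrightarrow> ((\<lambda>v. A u v) has_real_derivative M u v) (at v within {c..d})"
  obtains u v where "u \<in> {a..b}" "v \<in> {c..d}"
    "F b d - F b c - F a d + F a c = M u v * (b - a) * (d - c)"
proof -
  have "\<exists>u\<in>{a..b}. (\<lambda>u. F u d - F u c) b - (\<lambda>u. F u d - F u c) a = (\<lambda>h. h * (A u d - A u c)) (b - a)"
  proof (rule mvt_very_simple[OF \<open>a \<le> b\<close>])
    fix u assume "a \<le> u" "u \<le> b"
    then have "((\<lambda>u. F u d - F u c) has_real_derivative A u d - A u c) (at u within {a..b})"
      using F assms(2) by (intro DERIV_diff) auto
    then show "((\<lambda>u. F u d - F u c) has_derivative (\<lambda>h. h * (A u d - A u c))) (at u within {a..b})"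
      by (simp add: has_field_derivative_def mult_commute_abs)
  qed
  then obtain u where u: "u \<in> {a..b}" "F b d - F b c - (F a d - F a c) = (b - a) * (A u d - A u c)"
    by auto
  have "\<exists>v\<in>{c..d}. A u d - A u c = (\<lambda>h. h * M u v) (d - c)"
  proof (rule mvt_very_simple[OF \<open>c \<le> d\<close>])
    fix v assume "c \<le> v" "v \<le> d"
    then show "(A u has_derivative (\<lambda>h. h * M u v)) (at v within {c..d})"
      using A[OF u(1), of v] by (simp add: has_field_derivative_def mult_commute_abs)
  qed
  then obtain v where v: "v \<in> {c..d}" "A u d - A u c = (d - c) * M u v"
    by auto
  show ?thesis
    using that[OF u(1) v(1)] u(2) v(2) by (simp add: algebra_simps)
qed

lemma has_real_derivative_fst_section:
  assumes "(F has_derivative D) (at (u, v) within J \<times> K)" "v \<in> K" "I \<subseteq> J"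
  shows "((\<lambda>u. F (u, v)) has_real_derivative D (1, 0)) (at u within I)"
proof -
  have "((\<lambda>u. (u, v)) has_derivative (\<lambda>h. (h, 0))) (at u within I)"
    by (auto intro!: derivative_eq_intros)
  moreover have "(F has_derivative D) (at (u, v) within (\<lambda>u. (u, v)) ` I)"
    by (rule has_derivative_subset[OF assms(1)]) (use assms in auto)
  ultimately have "((\<lambda>u. F (u, v)) has_derivative (\<lambda>h. D (h, 0))) (at u within I)"
    by (rule has_derivative_in_compose[of "\<lambda>u. (u, v)" "\<lambda>h. (h, 0)" u I F D])
  moreover have "(\<lambda>h. D (h, 0)) = (*) (D (1, 0))"
  proof
    show "D (h, 0) = D (1, 0) * h" for h
      using linear_cmul[OF has_derivative_linear[OF assms(1)], of h "(1, 0)"] by simp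
  qed
  ultimately show ?thesis
    by (simp add: has_field_derivative_def)
qed

lemma has_real_derivative_snd_section:
  assumes "(F has_derivative D) (at (u, v) within J \<times> K)" "u \<in> J" "I \<subseteq> K"
  shows "((\<lambda>v. F (u, v)) has_real_derivative D (0, 1)) (at v within I)"
proof -
  have "((\<lambda>v. (u, v)) has_derivative (\<lambda>h. (0, h))) (at v within I)"
    by (auto intro!: derivative_eq_intros)
  moreover have "(F has_derivative D) (at (u, v) within (\<lambda>v. (u, v)) ` I)"
    by (rule has_derivative_subset[OF assms(1)]) (use assms in auto)
  ultimately have "((\<lambda>v. F (u, v)) has_derivative (\<lambda>h. D (0, h))) (at v within I)"
    by (rule has_derivative_in_compose[of "\<lambda>v. (u, v)" "\<lambda>h. (0, h)" v I F D])
  moreover have "(\<lambda>h. D (0, h)) = (*) (D (0, 1))"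
  proof
    show "D (0, h) = D (0, 1) * h" for h
      using linear_cmul[OF has_derivative_linear[OF assms(1)], of h "(0, 1)"] by simp
  qed
  ultimately show ?thesis
    by (simp add: has_field_derivative_def)
qed

lemma linear_dderiv: "smooth_on S F \<Longrightarrow> p \<in> S \<Longrightarrow> linear (dderiv S F p)"
  by (rule has_derivative_linear[OF smooth_on_has_derivative])

lemma approachable_segment:
  fixes J :: "real set"
  assumes "is_interval J" "approachable J" "u \<in> J" "e > 0"
  obtains a b where "a < b" "{a..b} \<subseteq> J" "{a..b} \<subseteq> ball u e"
proof -
  obtain d where d: "0 < \<bar>d\<bar>" "\<bar>d\<bar> < e" "u + d \<in> J"
    using approachable.approach[OF assms(2,3), of 1 e] assms(4) by auto
  have "{min u (u + d)..max u (u + d)} \<subseteq> J"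
  proof
    fix x assume "x \<in> {min u (u + d)..max u (u + d)}"
    then have "x \<in> closed_segment u (u + d)"
      by (auto simp: closed_segment_eq_real_ivl split: if_splits)
    then show "x \<in> J"
      using assms d by (meson closed_segment_subset is_interval_convex subsetD)
  qed
  moreover have "{min u (u + d)..max u (u + d)} \<subseteq> ball u e"
    using d by (auto simp: dist_real_def)
  ultimately show ?thesis
    using that[of "min u (u + d)" "max u (u + d)"] d by auto
qed

text \<open>
  Both mixed derivatives are limits of the same second difference quotient, also at points on
  the boundary of the domain, where small rectangles on the inner side are used.
\<close>

lemma mixed_partials_eq:
  fixes F :: "real \<times> real \<Rightarrow> real"
  assumes J: "is_interval J" "approachable J" and K: "is_interval K" "approachable K"
    and F: "smooth_on (J \<times> K) F" and p: "p \<in> J \<times> K"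
  shows "dderiv (J \<times> K) (\<lambda>q. dderiv (J \<times> K) F q (1, 0)) p (0, 1)
    = dderiv (J \<times> K) (\<lambda>q. dderiv (J \<times> K) F q (0, 1)) p (1, 0)" (is "?M p = ?N p")
proof (rule ccontr)
  let ?S = "J \<times> K"
  let ?A = "\<lambda>q. dderiv ?S F q (1, 0)" and ?B = "\<lambda>q. dderiv ?S F q (0, 1)"
  assume contra: "?M p \<noteq> ?N p"
  define \<epsilon> where "\<epsilon> = \<bar>?M p - ?N p\<bar> / 2"
  have \<epsilon>: "\<epsilon> > 0"
    using contra by (simp add: \<epsilon>_def)
  have smooth: "smooth_on ?S ?A" "smooth_on ?S ?B"
    using F by (rule smooth_on_dderiv)+
  have cont: "continuous_on ?S ?M" "continuous_on ?S ?N"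
    using smooth by (auto intro!: smooth_on_continuous smooth_on_dderiv)
  obtain \<delta> where \<delta>: "\<delta> > 0" "\<And>q. q \<in> ?S \<Longrightarrow> dist q p < \<delta> \<Longrightarrow> dist (?M q) (?M p) < \<epsilon>"
    using cont(1) p \<epsilon> unfolding continuous_on_iff by metis
  obtain \<delta>' where \<delta>': "\<delta>' > 0" "\<And>q. q \<in> ?S \<Longrightarrow> dist q p < \<delta>' \<Longrightarrow> dist (?N q) (?N p) < \<epsilon>"
    using cont(2) p \<epsilon> unfolding continuous_on_iff by metis
  define e where "e = min \<delta> \<delta>' / 2"
  have e: "e > 0"
    using \<delta> \<delta>' by (simp add: e_def)
  obtain a b where ab: "a < b" "{a..b} \<subseteq> J" "{a..b} \<subseteq> ball (fst p) e"
    by (rule approachable_segment[OF J _ e, of "fst p"]) (use p in auto)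
  obtain c d where cd: "c < d" "{c..d} \<subseteq> K" "{c..d} \<subseteq> ball (snd p) e"
    by (rule approachable_segment[OF K _ e, of "snd p"]) (use p in auto)
  have near: "(u, v) \<in> ?S" "dist (u, v) p < \<delta>" "dist (u, v) p < \<delta>'"
    if "u \<in> {a..b}" "v \<in> {c..d}" for u v
  proof -
    have "dist (u, v) p \<le> dist u (fst p) + dist v (snd p)"
      by (cases p) (simp add: dist_Pair_Pair sqrt_sum_squares_le_sum)
    also have "\<dots> < e + e"
      using ab(3) cd(3) that by (intro add_strict_mono) (auto simp: subset_eq dist_commute)
    finally show "dist (u, v) p < \<delta>" "dist (u, v) p < \<delta>'"
      by (auto simp: e_def min_def split: if_splits)
    show "(u, v) \<in> ?S"
      using ab(2) cd(2) that by auto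
  qed
  have sections: "((\<lambda>u. G (u, v)) has_real_derivative dderiv ?S G (u, v) (1, 0)) (at u within {a..b})"
      "((\<lambda>v. G (u, v)) has_real_derivative dderiv ?S G (u, v) (0, 1)) (at v within {c..d})"
    if "smooth_on ?S G" "u \<in> {a..b}" "v \<in> {c..d}" for G :: "real \<times> real \<Rightarrow> real" and u v
  proof -
    have q: "(u, v) \<in> ?S"
      using near that by blast
    note D = smooth_on_has_derivative[OF that(1) q]
    show "((\<lambda>u. G (u, v)) has_real_derivative dderiv ?S G (u, v) (1, 0)) (at u within {a..b})"
      by (rule has_real_derivative_fst_section[OF D _ ab(2)]) (use q in auto)
    show "((\<lambda>v. G (u, v)) has_real_derivative dderiv ?S G (u, v) (0, 1)) (at v within {c..d})"
      by (rule has_real_derivative_snd_section[OF D _ cd(2)]) (use q in auto)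
  qed
  obtain u v where uv: "u \<in> {a..b}" "v \<in> {c..d}"
    "F (b, d) - F (b, c) - F (a, d) + F (a, c) = ?M (u, v) * (b - a) * (d - c)"
    by (rule second_difference_mean_value[of a b c d "\<lambda>u v. F (u, v)" "\<lambda>u v. ?A (u, v)" "\<lambda>u v. ?M (u, v)"])
      (use ab cd sections(1)[OF F] sections(2)[OF smooth(1)] in auto)
  obtain v' u' where uv': "v' \<in> {c..d}" "u' \<in> {a..b}"
    "F (b, d) - F (a, d) - F (b, c) + F (a, c) = ?N (u', v') * (d - c) * (b - a)"
    by (rule second_difference_mean_value[of c d a b "\<lambda>v u. F (u, v)" "\<lambda>v u. ?B (u, v)" "\<lambda>v u. ?N (u, v)"])
      (use ab cd sections(2)[OF F] sections(1)[OF smooth(2)] in auto)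
  have "?M (u, v) * ((b - a) * (d - c)) = ?N (u', v') * ((b - a) * (d - c))"
    using uv(3) uv'(3) by (simp add: algebra_simps)
  then have "?M (u, v) = ?N (u', v')"
    using ab cd by simp
  moreover have "\<bar>?M (u, v) - ?M p\<bar> < \<epsilon>" "\<bar>?N (u', v') - ?N p\<bar> < \<epsilon>"
    using \<delta>(2) \<delta>'(2) near uv uv' by (auto simp: dist_real_def)
  moreover have "\<not> (\<bar>x - m\<bar> < \<bar>m - n\<bar> / 2 \<and> \<bar>x - n\<bar> < \<bar>m - n\<bar> / 2)" for m n x :: real
    using abs_triangle_ineq4[of "x - m" "x - n"] by (simp add: abs_minus_commute)
  ultimately show False
    unfolding \<epsilon>_def by metis
qed

lemma dderiv_commute:
  fixes F :: "real \<times> real \<Rightarrow> real"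
  assumes J: "is_interval J" "approachable J" and K: "is_interval K" "approachable K"
    and F: "smooth_on (J \<times> K) F" and p: "p \<in> J \<times> K"
  shows "dderiv (J \<times> K) (\<lambda>q. dderiv (J \<times> K) F q a) p b
    = dderiv (J \<times> K) (\<lambda>q. dderiv (J \<times> K) F q b) p a"
proof -
  let ?S = "J \<times> K"
  interpret S: approachable ?S
    using approachable_Times J(2) K(2) .
  have lin: "dderiv ?S G q c = fst c * dderiv ?S G q (1, 0) + snd c * dderiv ?S G q (0, 1)"
    if "smooth_on ?S G" "q \<in> ?S" for G :: "real \<times> real \<Rightarrow> real" and q c
  proof -
    have "dderiv ?S G q (fst c *\<^sub>R (1, 0) + snd c *\<^sub>R (0, 1))
        = fst c * dderiv ?S G q (1, 0) + snd c * dderiv ?S G q (0, 1)"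
      by (simp only: linear_add[OF linear_dderiv[OF that]] linear_cmul[OF linear_dderiv[OF that]] real_scaleR_def)
    then show ?thesis
      by simp
  qed
  have second: "dderiv ?S (\<lambda>q. dderiv ?S F q c) p d
      = fst c * dderiv ?S (\<lambda>q. dderiv ?S F q (1, 0)) p d + snd c * dderiv ?S (\<lambda>q. dderiv ?S F q (0, 1)) p d" for c d
  proof -
    have "dderiv ?S (\<lambda>q. dderiv ?S F q c) p
        = dderiv ?S (\<lambda>q. fst c * dderiv ?S F q (1, 0) + snd c * dderiv ?S F q (0, 1)) p"
      using lin[OF F] p by (rule dderiv_cong)
    also have "\<dots> = (\<lambda>d. fst c * dderiv ?S (\<lambda>q. dderiv ?S F q (1, 0)) p d
        + snd c * dderiv ?S (\<lambda>q. dderiv ?S F q (0, 1)) p d)"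
      by (rule S.dderiv_eqI)
         (intro has_derivative_add has_derivative_mult_right smooth_on_has_derivative
            smooth_on_dderiv F p)+
    finally show ?thesis
      by simp
  qed
  show ?thesis
    unfolding second[of a] second[of b] lin[OF smooth_on_dderiv[OF F] p, of _ a] lin[OF smooth_on_dderiv[OF F] p, of _ b]
    unfolding mixed_partials_eq[OF assms] by (simp only: algebra_simps)
qed

section \<open>Pseudo-Euclidean linear algebra and the rotating frame\<close>

lemma vector_4 [simp]:
  "(vector [a, b, c, d] :: ('a::zero)^4) $ 1 = a"
  "(vector [a, b, c, d] :: ('a::zero)^4) $ 2 = b"
  "(vector [a, b, c, d] :: ('a::zero)^4) $ 3 = c"
  "(vector [a, b, c, d] :: ('a::zero)^4) $ 4 = d"
  unfolding vector_def by auto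

lemma vec4_eq_iff: "(x :: 'a^4) = y \<longleftrightarrow> x $ 1 = y $ 1 \<and> x $ 2 = y $ 2 \<and> x $ 3 = y $ 3 \<and> x $ 4 = y $ 4"
  by (simp add: vec_eq_iff forall_4)

lemma has_derivative_vec_iff:
  fixes F :: "'a::real_normed_vector \<Rightarrow> real^'n"
  shows "(F has_derivative F') (at p within S) \<longleftrightarrow>
    (\<forall>i. ((\<lambda>q. F q $ i) has_derivative (\<lambda>a. F' a $ i)) (at p within S))"
  by (subst has_derivative_componentwise_within) (auto simp: Basis_vec_def inner_axis)

lemma E42_inner_commute: "E42_inner x y = E42_inner y x"
  and E42_inner_add_left: "E42_inner (x + y) w = E42_inner x w + E42_inner y w"
  and E42_inner_diff_left: "E42_inner (x - y) w = E42_inner x w - E42_inner y w"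
  and E42_inner_scaleR_left: "E42_inner (c *\<^sub>R x) w = c * E42_inner x w"
  and E42_inner_add_right: "E42_inner w (x + y) = E42_inner w x + E42_inner w y"
  and E42_inner_diff_right: "E42_inner w (x - y) = E42_inner w x - E42_inner w y"
  and E42_inner_scaleR_right: "E42_inner w (c *\<^sub>R x) = c * E42_inner w x"
  and E42_inner_minus_left: "E42_inner (- x) w = - E42_inner x w"
  and E42_inner_zero_left: "E42_inner 0 x = 0"
  and E42_inner_zero_right: "E42_inner x 0 = 0"
  by (simp_all add: E42_inner_def algebra_simps)

lemmas E42_inner_simps = E42_inner_add_left E42_inner_diff_left E42_inner_scaleR_left E42_inner_minus_left
  E42_inner_add_right E42_inner_diff_right E42_inner_scaleR_right E42_inner_zero_left E42_inner_zero_right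

text \<open>
  Gram--Schmidt: the metric restricted to a plane with an orthogonal basis of non-null vectors is
  nondegenerate, so the tangential component is determined by inner products alone.
\<close>

lemma normal_part_orthogonal_basis:
  assumes dz: "\<And>a. dderiv S z p a = (r * fst a) *\<^sub>R t\<^sub>1 + (s * snd a) *\<^sub>R t\<^sub>2"
    and "r \<noteq> 0" "s \<noteq> 0"
    and "E42_inner t\<^sub>1 t\<^sub>1 = e\<^sub>1" "E42_inner t\<^sub>2 t\<^sub>2 = e\<^sub>2" "E42_inner t\<^sub>1 t\<^sub>2 = 0" "e\<^sub>1 \<noteq> 0" "e\<^sub>2 \<noteq> 0"
  shows "normal_part S z p w
    = w - (E42_inner w t\<^sub>1 / e\<^sub>1) *\<^sub>R t\<^sub>1 - (E42_inner w t\<^sub>2 / e\<^sub>2) *\<^sub>R t\<^sub>2"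
proof -
  have tangent: "x \<in> tangent_space S z p \<longleftrightarrow> (\<exists>c d. x = c *\<^sub>R t\<^sub>1 + d *\<^sub>R t\<^sub>2)" for x
  proof
    assume "\<exists>c d. x = c *\<^sub>R t\<^sub>1 + d *\<^sub>R t\<^sub>2"
    then obtain c d where "x = c *\<^sub>R t\<^sub>1 + d *\<^sub>R t\<^sub>2"
      by blast
    then have "x = dderiv S z p (c / r, d / s)"
      using assms(2,3) by (simp add: dz)
    then show "x \<in> tangent_space S z p"
      by (simp add: tangent_space_def)
  qed (auto simp: tangent_space_def dz)
  have t: "t\<^sub>1 \<in> tangent_space S z p" "t\<^sub>2 \<in> tangent_space S z p"
    unfolding tangent by (metis add.right_neutral scaleR_one scaleR_zero_left, metis add.left_neutral scaleR_one scaleR_zero_left)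
  have normal: "n \<in> normal_space S z p \<longleftrightarrow> E42_inner n t\<^sub>1 = 0 \<and> E42_inner n t\<^sub>2 = 0" for n
  proof
    assume "n \<in> normal_space S z p"
    then show "E42_inner n t\<^sub>1 = 0 \<and> E42_inner n t\<^sub>2 = 0"
      using t by (simp add: normal_space_def)
  qed (auto simp: normal_space_def tangent E42_inner_simps)
  let ?n = "w - (E42_inner w t\<^sub>1 / e\<^sub>1) *\<^sub>R t\<^sub>1 - (E42_inner w t\<^sub>2 / e\<^sub>2) *\<^sub>R t\<^sub>2"
  have 21: "E42_inner t\<^sub>2 t\<^sub>1 = 0"
    using assms(6) E42_inner_commute by metis
  show ?thesis
    unfolding normal_part_def
  proof (rule the_equality)
    have "?n \<in> normal_space S z p"
      using assms 21 by (simp add: normal E42_inner_simps)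
    moreover have "w - ?n \<in> tangent_space S z p"
      unfolding tangent by (rule exI[of _ "E42_inner w t\<^sub>1 / e\<^sub>1"], rule exI[of _ "E42_inner w t\<^sub>2 / e\<^sub>2"]) simp
    ultimately show "?n \<in> normal_space S z p \<and> w - ?n \<in> tangent_space S z p"
      by blast
    fix n assume n: "n \<in> normal_space S z p \<and> w - n \<in> tangent_space S z p"
    then obtain c d where cd: "w - n = c *\<^sub>R t\<^sub>1 + d *\<^sub>R t\<^sub>2"
      using tangent by blast
    have w: "w = n + c *\<^sub>R t\<^sub>1 + d *\<^sub>R t\<^sub>2"
      using cd by (simp add: algebra_simps)
    have "E42_inner w t\<^sub>1 = c * e\<^sub>1" "E42_inner w t\<^sub>2 = d * e\<^sub>2"
      using n assms 21 unfolding w by (simp_all add: normal E42_inner_simps)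
    then show "n = ?n"
      using assms w by simp
  qed
qed

lemma (in approachable) smooth_on_E42_inner:
  assumes "smooth_on S F" "smooth_on S G"
  shows "smooth_on S (\<lambda>p. E42_inner (F p) (G p))"
  unfolding E42_inner_def
  by (intro smooth_on_add smooth_on_diff smooth_on_mult smooth_on_linear[OF bounded_linear_vec_nth] assms)

lemma independent_orthogonal_pair:
  assumes "E42_inner x y = 0" "E42_inner x x \<noteq> 0" "E42_inner y y \<noteq> 0"
  shows "x \<noteq> y" "independent {x, y}"
proof -
  show "x \<noteq> y"
    using assms by auto
  have "x \<notin> span {y}"
    using assms E42_inner_commute[of x y] by (auto simp: span_singleton E42_inner_simps)
  moreover have "y \<noteq> 0"
    using assms(3) by (auto simp: E42_inner_simps)
  ultimately show "independent {x, y}"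
    using \<open>x \<noteq> y\<close> by (simp add: independent_insert)
qed

text \<open>
  The one-parameter group of rotations with speeds \<open>\<alpha>\<close> and \<open>\<beta>\<close> whose orbits are the curves
  \<open>u = const\<close>, and its generator.
\<close>

definition rot4 :: "real \<Rightarrow> real \<Rightarrow> real \<Rightarrow> real^4 \<Rightarrow> real^4" where
  "rot4 \<alpha> \<beta> v x = vector
     [cos (\<alpha> * v) * x$1 - sin (\<alpha> * v) * x$2, sin (\<alpha> * v) * x$1 + cos (\<alpha> * v) * x$2,
      cos (\<beta> * v) * x$3 - sin (\<beta> * v) * x$4, sin (\<beta> * v) * x$3 + cos (\<beta> * v) * x$4]"

definition rot4_generator :: "real \<Rightarrow> real \<Rightarrow> real^4 \<Rightarrow> real^4" where
  "rot4_generator \<alpha> \<beta> x = vector [- \<alpha> * x$2, \<alpha> * x$1, - \<beta> * x$4, \<beta> * x$3]"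

lemma rot4_add: "rot4 \<alpha> \<beta> v (x + y) = rot4 \<alpha> \<beta> v x + rot4 \<alpha> \<beta> v y"
  and rot4_diff: "rot4 \<alpha> \<beta> v (x - y) = rot4 \<alpha> \<beta> v x - rot4 \<alpha> \<beta> v y"
  and rot4_scaleR: "rot4 \<alpha> \<beta> v (c *\<^sub>R x) = c *\<^sub>R rot4 \<alpha> \<beta> v x"
  by (simp_all add: vec4_eq_iff rot4_def algebra_simps)

lemma E42_inner_rot4 [simp]: "E42_inner (rot4 \<alpha> \<beta> v x) (rot4 \<alpha> \<beta> v y) = E42_inner x y"
proof -
  have "(c * x1 - s * x2) * (c * y1 - s * y2) + (s * x1 + c * x2) * (s * y1 + c * y2)
      = (s\<^sup>2 + c\<^sup>2) * (x1 * y1 + x2 * y2)" for c s x1 x2 y1 y2 :: real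
    by algebra
  from this[of "cos (\<alpha> * v)" "x$1" "sin (\<alpha> * v)" "x$2" "y$1" "y$2"]
    this[of "cos (\<beta> * v)" "x$3" "sin (\<beta> * v)" "x$4" "y$3" "y$4"]
  show ?thesis
    by (simp add: E42_inner_def rot4_def)
qed

lemma rot4_rot4_minus: "rot4 \<alpha> \<beta> v (rot4 \<alpha> \<beta> (- v) x) = x"
proof -
  have "c * (c * y + s * y') - s * (c * y' - s * y) = (s\<^sup>2 + c\<^sup>2) * y
      \<and> s * (c * y + s * y') + c * (c * y' - s * y) = (s\<^sup>2 + c\<^sup>2) * y'" for c s y y' :: real
    by algebra
  from this[of "cos (\<alpha> * v)" "x$1" "sin (\<alpha> * v)" "x$2"] this[of "cos (\<beta> * v)" "x$3" "sin (\<beta> * v)" "x$4"]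
  show ?thesis
    by (simp add: vec4_eq_iff rot4_def)
qed

text \<open>
  The derivative of a field written in the rotating frame is the derivative of its components
  plus a term from the rotation, which involves the generator only.
\<close>

lemma has_derivative_rot4:
  assumes "(X has_derivative X') (at p within S)"
  shows "((\<lambda>q. rot4 \<alpha> \<beta> (snd q) (X q)) has_derivative
    (\<lambda>a. rot4 \<alpha> \<beta> (snd p) (X' a + snd a *\<^sub>R rot4_generator \<alpha> \<beta> (X p)))) (at p within S)"
proof -
  have X: "((\<lambda>q. X q $ i) has_derivative (\<lambda>a. X' a $ i)) (at p within S)" for i
    using assms has_derivative_vec_iff by blast
  show ?thesis
    unfolding has_derivative_vec_iff forall_4 rot4_def rot4_generator_def
    by (auto intro!: derivative_eq_intros X simp: fun_eq_iff algebra_simps)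
qed

lemma (in approachable) smooth_on_rot4:
  assumes "smooth_on S s" "\<And>i. smooth_on S (\<lambda>p. X p $ i)"
  shows "smooth_on S (\<lambda>p. rot4 \<alpha> \<beta> (s p) (X p))"
proof (rule smooth_on_vec)
  show "smooth_on S (\<lambda>p. rot4 \<alpha> \<beta> (s p) (X p) $ i)" for i
    using exhaust_4[of i]
    by (elim disjE; simp add: rot4_def)
       (intro smooth_on_add smooth_on_diff smooth_on_mult smooth_on_sin smooth_on_cos smooth_on_const assms)+
qed

lemma has_derivative_compose_fst:
  assumes "(F has_derivative D) (at (fst p) within J)" "p \<in> J \<times> K"
  shows "((\<lambda>q. F (fst q)) has_derivative (\<lambda>a. D (fst a))) (at p within J \<times> K)"
proof (rule has_derivative_in_compose[of fst fst p "J \<times> K" F D])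
  show "(fst has_derivative fst) (at p within J \<times> K)"
    by (auto intro!: derivative_eq_intros)
  show "(F has_derivative D) (at (fst p) within fst ` (J \<times> K))"
    by (rule has_derivative_subset[OF assms(1)]) auto
qed

lemma smooth_on_fst:
  fixes F :: "real \<Rightarrow> real"
  assumes "approachable J" "approachable K" "smooth_on J F"
  shows "smooth_on (J \<times> K) (\<lambda>p :: real \<times> real. F (fst p))"
proof -
  interpret S: approachable "J \<times> K"
    using approachable_Times assms by blast
  have "Ck_on k (J \<times> K) (\<lambda>p. F (fst p))" if "\<And>k. Ck_on k J F" for k
    using that
  proof (induction k arbitrary: F)
    case 0
    have "continuous_on J F"
      using 0[of 0] by simp
    then show ?case
      by (auto intro!: continuous_on_compose2[of J F] continuous_intros)
  next
    case (Suc k)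
    show ?case
    proof (rule S.Ck_on_SucI)
      show "((\<lambda>p. F (fst p)) has_derivative (\<lambda>a. dderiv J F (fst p) (fst a))) (at p within J \<times> K)"
        if "p \<in> J \<times> K" for p
        using that Suc.prems by (intro has_derivative_compose_fst Ck_on_has_derivative) auto
      have "Ck_on k (J \<times> K) (\<lambda>p. fst a * dderiv J F (fst p) 1)" for a
        using Suc.IH[of "\<lambda>u. dderiv J F u 1"] Suc.prems
        by (intro S.Ck_on_bilinear[OF bounded_bilinear_mult S.Ck_on_const]) (metis Ck_on.simps(2))
      then show "Ck_on k (J \<times> K) (\<lambda>p. dderiv J F (fst p) (fst a))" for a
      proof (rule Ck_on_cong[rotated])
        fix p assume "p \<in> J \<times> K"
        then have "linear (dderiv J F (fst p))"
          using has_derivative_linear[OF Ck_on_has_derivative[OF Suc.prems]] by auto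
        from linear_cmul[OF this, of "fst a" 1]
        show "fst a * dderiv J F (fst p) 1 = dderiv J F (fst p) (fst a)"
          by simp
      qed
    qed
  qed
  then show ?thesis
    using assms(3) unfolding smooth_on_def by blast
qed

section \<open>Geometry of the rotational surface\<close>

locale elliptic_rotational_surface =
  fixes \<alpha> \<beta> :: real and J :: "real set" and f g f' g' :: "real \<Rightarrow> real"
    and S :: "(real \<times> real) set" and z :: "real \<times> real \<Rightarrow> real^4"
  assumes \<alpha>: "\<alpha> > 0" and \<beta>: "\<beta> > 0"
    and J: "is_interval J" "interior J \<noteq> {}"
    and f: "smooth_on J f" and g: "smooth_on J g"
    and f': "\<And>u. u \<in> J \<Longrightarrow> (f has_real_derivative f' u) (at u within J)"
    and g': "\<And>u. u \<in> J \<Longrightarrow> (g has_real_derivative g' u) (at u within J)"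
    and G_neg: "\<And>u. u \<in> J \<Longrightarrow> \<alpha>\<^sup>2 * (f u)\<^sup>2 - \<beta>\<^sup>2 * (g u)\<^sup>2 < 0"
    and E_pos: "\<And>u. u \<in> J \<Longrightarrow> (f' u)\<^sup>2 - (g' u)\<^sup>2 > 0"
    and S: "S = J \<times> {0..<2 * pi}"
    and z: "z = rotational_surface \<alpha> \<beta> f g"
begin

lemma approachable_J: "approachable J" and approachable_angles: "approachable {0..<2 * pi}"
  using J pi_gt_zero by (auto intro!: approachable_interval simp: is_interval_co simp del: pi_gt_zero)

lemma approachable_S: "approachable S"
  unfolding S by (rule approachable_Times[OF approachable_J approachable_angles])

sublocale J: approachable J
  by (rule approachable_J)

sublocale S: approachable S
  by (rule approachable_S)

lemma smooth_on_S:
  fixes \<phi> :: "real \<Rightarrow> real"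
  shows "smooth_on J \<phi> \<Longrightarrow> smooth_on S (\<lambda>p. \<phi> (fst p))"
  unfolding S by (rule smooth_on_fst[OF approachable_J approachable_angles])

lemma derivative_unique_J:
  assumes "(\<phi> has_real_derivative d) (at u within J)" "(\<psi> has_real_derivative e) (at u within J)"
    and "\<And>t. t \<in> J \<Longrightarrow> \<phi> t = \<psi> t" "u \<in> J"
  shows "d = e"
proof -
  have "(*) d = dderiv J \<phi> u" "(*) e = dderiv J \<psi> u"
    using assms by (auto intro!: J.dderiv_eqI[symmetric] simp: has_field_derivative_def)
  moreover have "dderiv J \<phi> u = dderiv J \<psi> u"
    using assms(3,4) by (rule dderiv_cong)
  ultimately have "(*) d = (*) e"
    by simp
  then have "d * 1 = e * 1"
    by (rule fun_cong)
  then show ?thesis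
    by simp
qed

lemma smooth_has_real_derivative:
  assumes "smooth_on J \<phi>" "u \<in> J"
  shows "(\<phi> has_real_derivative dderiv J \<phi> u 1) (at u within J)"
proof -
  note d = smooth_on_has_derivative[OF assms]
  have "dderiv J \<phi> u = (*) (dderiv J \<phi> u 1)"
  proof
    show "dderiv J \<phi> u h = dderiv J \<phi> u 1 * h" for h
      using linear_cmul[OF has_derivative_linear[OF d], of h 1] by simp
  qed
  then show ?thesis
    using d unfolding has_field_derivative_def by simp
qed

lemma has_derivative_S:
  assumes "(\<phi> has_real_derivative d) (at (fst p) within J)" "p \<in> S"
  shows "((\<lambda>q. \<phi> (fst q)) has_derivative (\<lambda>a. d * fst a)) (at p within S)"
  using has_derivative_compose_fst[of \<phi> "(*) d" p J "{0..<2 * pi}"] assms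
  by (simp add: S has_field_derivative_def)

lemma f'_eq: "u \<in> J \<Longrightarrow> f' u = dderiv J f u 1" and g'_eq: "u \<in> J \<Longrightarrow> g' u = dderiv J g u 1"
  using derivative_unique_J[OF f' smooth_has_real_derivative[OF f]]
    derivative_unique_J[OF g' smooth_has_real_derivative[OF g]] by auto

lemma smooth_f': "smooth_on J f'" and smooth_g': "smooth_on J g'"
  by (rule smooth_on_cong[OF _ smooth_on_dderiv[OF f, of 1]], simp add: f'_eq)
     (rule smooth_on_cong[OF _ smooth_on_dderiv[OF g, of 1]], simp add: g'_eq)

definition f'' where "f'' u = dderiv J f' u 1"

definition g'' where "g'' u = dderiv J g' u 1"

lemma f'': "u \<in> J \<Longrightarrow> (f' has_real_derivative f'' u) (at u within J)"
  and g'': "u \<in> J \<Longrightarrow> (g' has_real_derivative g'' u) (at u within J)"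
  by (simp_all add: f''_def g''_def smooth_has_real_derivative smooth_f' smooth_g')

lemma smooth_f'': "smooth_on J f''" and smooth_g'': "smooth_on J g''"
  unfolding f''_def g''_def by (simp_all add: smooth_on_dderiv smooth_f' smooth_g')

definition E where "E u = (f' u)\<^sup>2 - (g' u)\<^sup>2"

definition W where "W u = \<beta>\<^sup>2 * (g u)\<^sup>2 - \<alpha>\<^sup>2 * (f u)\<^sup>2"

lemma E: "u \<in> J \<Longrightarrow> E u > 0" and W: "u \<in> J \<Longrightarrow> W u > 0"
  using E_pos[of u] G_neg[of u] by (auto simp: E_def W_def)

lemma smooth_E: "smooth_on J E" and smooth_W: "smooth_on J W"
  unfolding E_def W_def power2_eq_square
  by (intro J.smooth_on_diff J.smooth_on_mult J.smooth_on_const f g smooth_f' smooth_g')+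

lemma g_nonzero: "u \<in> J \<Longrightarrow> g u \<noteq> 0"
  using W[of u] by (auto simp: W_def mult_less_0_iff)

lemma f'_nonzero: "u \<in> J \<Longrightarrow> f' u \<noteq> 0"
  using E[of u] by (auto simp: E_def)

text \<open>
  In the rotating frame the unit tangents of the parameter lines are
  \<open>(n13, 0, n11, 0)\<close> and \<open>(0, n24, 0, n22)\<close>, and unit normals are
  \<open>(n11, 0, n13, 0)\<close> (timelike) and \<open>(0, n22, 0, n24)\<close> (spacelike).
\<close>

definition n11 where "n11 u = g' u * (1 / sqrt (E u))"

definition n13 where "n13 u = f' u * (1 / sqrt (E u))"

definition n22 where "n22 u = \<beta> * g u * (1 / sqrt (W u))"

definition n24 where "n24 u = \<alpha> * f u * (1 / sqrt (W u))"

definition \<nu>\<^sub>1 where "\<nu>\<^sub>1 p = rot4 \<alpha> \<beta> (snd p) (vector [n11 (fst p), 0, n13 (fst p), 0])"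

definition \<nu>\<^sub>2 where "\<nu>\<^sub>2 p = rot4 \<alpha> \<beta> (snd p) (vector [0, n22 (fst p), 0, n24 (fst p)])"

lemma smooth_n: "smooth_on J n11" "smooth_on J n13" "smooth_on J n22" "smooth_on J n24"
  unfolding n11_def n13_def n22_def n24_def
  by (intro J.smooth_on_mult J.smooth_on_inverse_sqrt J.smooth_on_const f g smooth_f' smooth_g'
        smooth_E smooth_W E W; assumption)+

lemma n_unit: "u \<in> J \<Longrightarrow> (n13 u)\<^sup>2 = (n11 u)\<^sup>2 + 1" "u \<in> J \<Longrightarrow> (n22 u)\<^sup>2 = (n24 u)\<^sup>2 + 1"
  using E[of u] W[of u]
  by (auto simp: n11_def n13_def n22_def n24_def power_mult_distrib power_divide field_simps)
    (auto simp: E_def W_def)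

lemma tangent_n:
  "u \<in> J \<Longrightarrow> f' u = sqrt (E u) * n13 u" "u \<in> J \<Longrightarrow> g' u = sqrt (E u) * n11 u"
  "u \<in> J \<Longrightarrow> \<alpha> * f u = sqrt (W u) * n24 u" "u \<in> J \<Longrightarrow> \<beta> * g u = sqrt (W u) * n22 u"
  using E[of u] W[of u] by (simp_all add: n11_def n13_def n22_def n24_def)

lemma z_eq: "z p = rot4 \<alpha> \<beta> (snd p) (vector [f (fst p), 0, g (fst p), 0])"
  by (cases p) (simp add: z rotational_surface_def rot4_def vec4_eq_iff mult.commute)

lemma z_has_derivative:
  assumes "p \<in> S"
  shows "(z has_derivative (\<lambda>a. rot4 \<alpha> \<beta> (snd p) (vector
     [fst a * f' (fst p), snd a * (\<alpha> * f (fst p)), fst a * g' (fst p), snd a * (\<beta> * g (fst p))]))) (at p within S)"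
proof -
  have u: "fst p \<in> J"
    using assms by (auto simp: S)
  note d = has_derivative_S[OF f'[OF u] assms] has_derivative_S[OF g'[OF u] assms]
  have "((\<lambda>q. vector [f (fst q), 0, g (fst q), 0] :: real^4) has_derivative
      (\<lambda>a. vector [f' (fst p) * fst a, 0, g' (fst p) * fst a, 0])) (at p within S)"
    unfolding has_derivative_vec_iff forall_4 using d by simp
  from has_derivative_rot4[OF this] show ?thesis
    unfolding z_eq[abs_def]
    by (rule has_derivative_eq_rhs) (simp add: fun_eq_iff vec4_eq_iff rot4_def rot4_generator_def algebra_simps)
qed

lemma dderiv_z:
  assumes "p \<in> S"
  shows "dderiv S z p = (\<lambda>a. rot4 \<alpha> \<beta> (snd p) (vector
     [fst a * f' (fst p), snd a * (\<alpha> * f (fst p)), fst a * g' (fst p), snd a * (\<beta> * g (fst p))]))"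
  using S.dderiv_eqI[OF z_has_derivative] assms by blast

lemma dderiv2_z:
  assumes "p \<in> S"
  shows "dderiv S (\<lambda>q. dderiv S z q b) p a = rot4 \<alpha> \<beta> (snd p) (vector
     [fst a * fst b * f'' (fst p) - snd a * snd b * (\<alpha>\<^sup>2 * f (fst p)),
      (fst a * snd b + snd a * fst b) * (\<alpha> * f' (fst p)),
      fst a * fst b * g'' (fst p) - snd a * snd b * (\<beta>\<^sup>2 * g (fst p)),
      (fst a * snd b + snd a * fst b) * (\<beta> * g' (fst p))])"
proof -
  have u: "fst p \<in> J"
    using assms by (auto simp: S)
  note d = has_derivative_S[OF f'[OF u] assms] has_derivative_S[OF g'[OF u] assms]
    has_derivative_S[OF f''[OF u] assms] has_derivative_S[OF g''[OF u] assms]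
  let ?X = "\<lambda>q. vector
     [fst b * f' (fst q), snd b * (\<alpha> * f (fst q)), fst b * g' (fst q), snd b * (\<beta> * g (fst q))] :: real^4"
  have "dderiv S (\<lambda>q. dderiv S z q b) p = dderiv S (\<lambda>q. rot4 \<alpha> \<beta> (snd q) (?X q)) p"
    by (rule dderiv_cong[OF _ assms]) (simp add: dderiv_z)
  also have "(?X has_derivative (\<lambda>a. vector
     [fst b * (f'' (fst p) * fst a), snd b * (\<alpha> * (f' (fst p) * fst a)),
      fst b * (g'' (fst p) * fst a), snd b * (\<beta> * (g' (fst p) * fst a))])) (at p within S)"
    unfolding has_derivative_vec_iff forall_4 using d by (auto intro!: has_derivative_mult_right)
  note S.dderiv_eqI[OF has_derivative_rot4[OF this] assms]
  finally have "dderiv S (\<lambda>q. dderiv S z q b) p a = rot4 \<alpha> \<beta> (snd p) (vector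
     [fst b * (f'' (fst p) * fst a), snd b * (\<alpha> * (f' (fst p) * fst a)),
      fst b * (g'' (fst p) * fst a), snd b * (\<beta> * (g' (fst p) * fst a))]
     + snd a *\<^sub>R rot4_generator \<alpha> \<beta> (?X p))"
    by (rule fun_cong)
  also have "\<dots> = rot4 \<alpha> \<beta> (snd p) (vector
     [fst a * fst b * f'' (fst p) - snd a * snd b * (\<alpha>\<^sup>2 * f (fst p)),
      (fst a * snd b + snd a * fst b) * (\<alpha> * f' (fst p)),
      fst a * fst b * g'' (fst p) - snd a * snd b * (\<beta>\<^sup>2 * g (fst p)),
      (fst a * snd b + snd a * fst b) * (\<beta> * g' (fst p))])"
    by (rule arg_cong[where f = "rot4 \<alpha> \<beta> (snd p)"])
       (simp add: vec4_eq_iff rot4_generator_def algebra_simps power2_eq_square)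
  finally show ?thesis .
qed

text \<open>
  The normal components of a vector are computed in the rotating frame, where the angle does
  not occur.
\<close>

lemma normal_part_rot4:
  assumes "p \<in> S"
  shows "normal_part S z p (rot4 \<alpha> \<beta> (snd p) w) =
    (w $ 3 * n13 (fst p) - w $ 1 * n11 (fst p)) *\<^sub>R \<nu>\<^sub>1 p + (w $ 2 * n22 (fst p) - w $ 4 * n24 (fst p)) *\<^sub>R \<nu>\<^sub>2 p"
proof -
  define u v where "u = fst p" and "v = snd p"
  have u: "u \<in> J"
    using assms by (auto simp: S u_def)
  let ?R = "rot4 \<alpha> \<beta> v"
  let ?t1 = "?R (vector [n13 u, 0, n11 u, 0])" and ?t2 = "?R (vector [0, n24 u, 0, n22 u])"
  note unit = n_unit[OF u, unfolded power2_eq_square]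
  have "normal_part S z p (?R w)
      = ?R w - (E42_inner (?R w) ?t1 / 1) *\<^sub>R ?t1 - (E42_inner (?R w) ?t2 / - 1) *\<^sub>R ?t2"
  proof (rule normal_part_orthogonal_basis)
    show "dderiv S z p a = (sqrt (E u) * fst a) *\<^sub>R ?t1 + (sqrt (W u) * snd a) *\<^sub>R ?t2" for a
      unfolding rot4_scaleR[symmetric] rot4_add[symmetric] dderiv_z[OF assms]
      unfolding u_def[symmetric] v_def[symmetric]
      by (rule arg_cong[where f = ?R]) (simp add: vec4_eq_iff tangent_n[OF u])
    show "sqrt (E u) \<noteq> 0" "sqrt (W u) \<noteq> 0"
      using E[OF u] W[OF u] by auto
  qed (unfold E42_inner_rot4, use unit in \<open>auto simp: E42_inner_def\<close>)
  also have "\<dots> = ?R ((w $ 3 * n13 u - w $ 1 * n11 u) *\<^sub>R vector [n11 u, 0, n13 u, 0]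
      + (w $ 2 * n22 u - w $ 4 * n24 u) *\<^sub>R vector [0, n22 u, 0, n24 u])"
    unfolding E42_inner_rot4 rot4_scaleR[symmetric] rot4_diff[symmetric]
    by (rule arg_cong[where f = ?R]) (use unit in \<open>simp add: vec4_eq_iff E42_inner_def; algebra\<close>)
  finally show ?thesis
    by (simp add: \<nu>\<^sub>1_def \<nu>\<^sub>2_def rot4_scaleR rot4_add u_def v_def)
qed

lemma orthonormal_frame:
  assumes "p \<in> S"
  shows "E42_inner (\<nu>\<^sub>1 p) (\<nu>\<^sub>1 p) = - 1" "E42_inner (\<nu>\<^sub>2 p) (\<nu>\<^sub>2 p) = 1" "E42_inner (\<nu>\<^sub>1 p) (\<nu>\<^sub>2 p) = 0"
proof -
  have u: "fst p \<in> J"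
    using assms by (auto simp: S)
  show "E42_inner (\<nu>\<^sub>1 p) (\<nu>\<^sub>1 p) = - 1" "E42_inner (\<nu>\<^sub>2 p) (\<nu>\<^sub>2 p) = 1" "E42_inner (\<nu>\<^sub>1 p) (\<nu>\<^sub>2 p) = 0"
    unfolding \<nu>\<^sub>1_def \<nu>\<^sub>2_def E42_inner_rot4
    using n_unit[OF u] by (simp_all add: E42_inner_def power2_eq_square)
qed

lemma inner_dderiv_z_frame:
  assumes "p \<in> S"
  shows "E42_inner (dderiv S z p a) (\<nu>\<^sub>1 p) = 0" "E42_inner (dderiv S z p a) (\<nu>\<^sub>2 p) = 0"
proof -
  have u: "fst p \<in> J"
    using assms by (auto simp: S)
  show "E42_inner (dderiv S z p a) (\<nu>\<^sub>1 p) = 0" "E42_inner (dderiv S z p a) (\<nu>\<^sub>2 p) = 0"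
    unfolding \<nu>\<^sub>1_def \<nu>\<^sub>2_def dderiv_z[OF assms] E42_inner_rot4
    by (simp_all add: E42_inner_def tangent_n[OF u])
qed

lemma normal_space_frame:
  assumes "p \<in> S"
  shows "\<nu>\<^sub>1 p \<in> normal_space S z p" "\<nu>\<^sub>2 p \<in> normal_space S z p"
  using inner_dderiv_z_frame[OF assms] E42_inner_commute
  by (auto simp: normal_space_def tangent_space_def)

lemma normal_part_eq:
  assumes "p \<in> S"
  shows "normal_part S z p x = - E42_inner x (\<nu>\<^sub>1 p) *\<^sub>R \<nu>\<^sub>1 p + E42_inner x (\<nu>\<^sub>2 p) *\<^sub>R \<nu>\<^sub>2 p"
proof -
  obtain w where x: "x = rot4 \<alpha> \<beta> (snd p) w"
    using rot4_rot4_minus by metis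
  show ?thesis
    unfolding x normal_part_rot4[OF assms] unfolding \<nu>\<^sub>1_def \<nu>\<^sub>2_def E42_inner_rot4
    by (simp add: E42_inner_def)
qed

lemma normal_decomposition:
  assumes p: "p \<in> S" and n: "n \<in> normal_space S z p"
  shows "n = - E42_inner n (\<nu>\<^sub>1 p) *\<^sub>R \<nu>\<^sub>1 p + E42_inner n (\<nu>\<^sub>2 p) *\<^sub>R \<nu>\<^sub>2 p"
proof -
  have u: "fst p \<in> J"
    using p by (auto simp: S)
  obtain w where w: "n = rot4 \<alpha> \<beta> (snd p) w"
    using rot4_rot4_minus by metis
  have "E42_inner n (dderiv S z p a) = 0" for a
    using n unfolding normal_space_def tangent_space_def by blast
  from this[of "(1, 0)"] this[of "(0, 1)"]
  have w0: "w $ 1 * n13 (fst p) = w $ 3 * n11 (fst p)" "w $ 2 * n24 (fst p) = w $ 4 * n22 (fst p)"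
    using E[OF u] W[OF u] unfolding w dderiv_z[OF p] E42_inner_rot4
    by (simp_all add: E42_inner_def tangent_n[OF u])
  note unit = n_unit[OF u, unfolded power2_eq_square]
  show ?thesis
    unfolding w \<nu>\<^sub>1_def \<nu>\<^sub>2_def E42_inner_rot4 unfolding rot4_scaleR[symmetric] rot4_add[symmetric]
    by (rule arg_cong[where f = "rot4 \<alpha> \<beta> (snd p)"])
       (use unit w0 in \<open>simp add: vec4_eq_iff E42_inner_def; algebra\<close>)
qed

text \<open>
  The rotating normal frame is parallel along the meridians, and along the orbits it turns with
  hyperbolic angular speed \<open>- \<kappa>\<close>.  Up to the factor \<open>\<alpha> \<beta>\<close>, \<open>\<kappa>\<close> is the quotient
  \<open>(f f' - g g') / (sqrt E sqrt W)\<close>.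
\<close>

definition \<kappa> where "\<kappa> u = \<beta> * n13 u * n24 u - \<alpha> * n11 u * n22 u"

lemma \<kappa>_eq:
  assumes "u \<in> J"
  shows "\<kappa> u = \<alpha> * \<beta> * ((f u * f' u - g u * g' u) / (sqrt (E u) * sqrt (W u)))"
  using E[OF assms] W[OF assms] by (simp add: \<kappa>_def n11_def n13_def n22_def n24_def field_simps)

lemma smooth_\<kappa>: "smooth_on J \<kappa>"
  unfolding \<kappa>_def by (intro J.smooth_on_diff J.smooth_on_mult J.smooth_on_const smooth_n)

text \<open>
  The components of the unit normals satisfy \<open>n13\<^sup>2 - n11\<^sup>2 = 1\<close> and \<open>n22\<^sup>2 - n24\<^sup>2 = 1\<close>, so their
  derivatives along the meridian are tangential and only the rotation contributes.
\<close>

lemma normal_connection_frame: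
  assumes p: "p \<in> S" and x: "(x has_derivative x') (at p within S)" and y: "(y has_derivative y') (at p within S)"
  shows "normal_connection S z a (\<lambda>q. x q *\<^sub>R \<nu>\<^sub>1 q + y q *\<^sub>R \<nu>\<^sub>2 q) p =
    (x' a - \<kappa> (fst p) * snd a * y p) *\<^sub>R \<nu>\<^sub>1 p + (y' a - \<kappa> (fst p) * snd a * x p) *\<^sub>R \<nu>\<^sub>2 p"
proof -
  define u where "u = fst p"
  have u: "u \<in> J"
    using p by (auto simp: S u_def)
  define d11 d13 d22 d24
    where "d11 = dderiv J n11 u 1" "d13 = dderiv J n13 u 1" "d22 = dderiv J n22 u 1" "d24 = dderiv J n24 u 1"
  note d = smooth_n[THEN smooth_has_real_derivative, OF u, folded d11_d13_d22_d24_def]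
  (* A unit vector is orthogonal to its derivative. *)
  have "2 * n13 u * d13 = 2 * n11 u * d11" "2 * n22 u * d22 = 2 * n24 u * d24"
    by (rule derivative_unique_J[of "\<lambda>u. (n13 u)\<^sup>2" _ u "\<lambda>u. (n11 u)\<^sup>2 + 1"];
        auto intro!: derivative_eq_intros d simp: n_unit u)
       (rule derivative_unique_J[of "\<lambda>u. (n22 u)\<^sup>2" _ u "\<lambda>u. (n24 u)\<^sup>2 + 1"];
        auto intro!: derivative_eq_intros d simp: n_unit u)
  then have unit': "n13 u * d13 = n11 u * d11" "n22 u * d22 = n24 u * d24"
    by simp_all
  let ?X = "\<lambda>q. vector [x q * n11 (fst q), y q * n22 (fst q), x q * n13 (fst q), y q * n24 (fst q)] :: real^4"
  let ?X' = "\<lambda>a. vector [x p * (d11 * fst a) + x' a * n11 u, y p * (d22 * fst a) + y' a * n22 u,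
     x p * (d13 * fst a) + x' a * n13 u, y p * (d24 * fst a) + y' a * n24 u] :: real^4"
  have "(?X has_derivative ?X') (at p within S)"
    unfolding has_derivative_vec_iff forall_4 u_def
    using d[unfolded u_def, THEN has_derivative_S, OF p] by (auto intro!: has_derivative_mult x y)
  note X = S.dderiv_eqI[OF has_derivative_rot4[OF this] p]
  have "normal_connection S z a (\<lambda>q. x q *\<^sub>R \<nu>\<^sub>1 q + y q *\<^sub>R \<nu>\<^sub>2 q) p
      = normal_part S z p (rot4 \<alpha> \<beta> (snd p) (?X' a + snd a *\<^sub>R rot4_generator \<alpha> \<beta> (?X p)))"
  proof -
    have "x q *\<^sub>R \<nu>\<^sub>1 q + y q *\<^sub>R \<nu>\<^sub>2 q = rot4 \<alpha> \<beta> (snd q) (?X q)" for q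
      unfolding \<nu>\<^sub>1_def \<nu>\<^sub>2_def rot4_scaleR[symmetric] rot4_add[symmetric]
      by (rule arg_cong[where f = "rot4 \<alpha> \<beta> (snd q)"]) (simp add: vec4_eq_iff)
    then show ?thesis
      unfolding normal_connection_def by (simp only: X)
  qed
  also have "\<dots> = (x' a - \<kappa> (fst p) * snd a * y p) *\<^sub>R \<nu>\<^sub>1 p + (y' a - \<kappa> (fst p) * snd a * x p) *\<^sub>R \<nu>\<^sub>2 p"
    unfolding normal_part_rot4[OF p]
  proof (intro arg_cong2[where f = "(+)"] arg_cong2[where f = "(*\<^sub>R)"] refl)
    note unit = n_unit[OF u, unfolded power2_eq_square]
    show "(?X' a + snd a *\<^sub>R rot4_generator \<alpha> \<beta> (?X p)) $ 3 * n13 (fst p) - (?X' a + snd a *\<^sub>R rot4_generator \<alpha> \<beta> (?X p)) $ 1 * n11 (fst p)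
      = x' a - \<kappa> (fst p) * snd a * y p"
      using unit unit' by (simp add: rot4_generator_def u_def[symmetric] \<kappa>_def) algebra
    show "(?X' a + snd a *\<^sub>R rot4_generator \<alpha> \<beta> (?X p)) $ 2 * n22 (fst p) - (?X' a + snd a *\<^sub>R rot4_generator \<alpha> \<beta> (?X p)) $ 4 * n24 (fst p)
      = y' a - \<kappa> (fst p) * snd a * x p"
      using unit unit' by (simp add: rot4_generator_def u_def[symmetric] \<kappa>_def) algebra
  qed
  finally show ?thesis .
qed

text \<open>
  Up to a positive factor, \<open>- K\<close> and \<open>- L\<close> are the \<open>\<nu>\<^sub>1\<close>-components of \<open>\<sigma>(\<partial>\<^sub>u, \<partial>\<^sub>u)\<close> and of
  \<open>\<sigma>(\<partial>\<^sub>v, \<partial>\<^sub>v)\<close>, whose \<open>\<nu>\<^sub>2\<close>-components vanish.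
\<close>

definition K where "K u = f'' u * g' u - f' u * g'' u"

definition L where "L u = \<beta>\<^sup>2 * g u * f' u - \<alpha>\<^sup>2 * f u * g' u"

text \<open>
  This is \<open>(L / W - K / E) / (2 sqrt E)\<close>, arranged as a product so that its smoothness can be
  read off.
\<close>

definition h where "h u = (E u * L u - W u * K u) * (1 / sqrt (E u)) * (1 / E u) * (1 / W u) / 2"

lemma smooth_h: "smooth_on J h"
  unfolding h_def K_def L_def divide_inverse[of _ 2]
  by (intro J.smooth_on_mult J.smooth_on_diff J.smooth_on_inverse_sqrt J.smooth_on_inverse J.smooth_on_const
     smooth_E smooth_W E W f g smooth_f' smooth_g' smooth_f'' smooth_g''; assumption)

lemma mean_curvature:
  assumes p: "p \<in> S"
  shows "mean_curvature_vector S z p = h (fst p) *\<^sub>R \<nu>\<^sub>1 p"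
proof -
  define u where "u = fst p"
  have u: "u \<in> J"
    using p by (auto simp: S u_def)
  have first: "first_form S z p (1, 0) (1, 0) = E u" "first_form S z p (1, 0) (0, 1) = 0"
    "first_form S z p (0, 1) (0, 1) = - W u"
    unfolding first_form_def dderiv_z[OF p] E42_inner_rot4
    by (simp_all add: E42_inner_def u_def E_def W_def power2_eq_square algebra_simps)
  have second: "second_form S z p (1, 0) (1, 0) = - (K u / sqrt (E u)) *\<^sub>R \<nu>\<^sub>1 p"
    "second_form S z p (0, 1) (0, 1) = - (L u / sqrt (E u)) *\<^sub>R \<nu>\<^sub>1 p"
    unfolding second_form_def dderiv2_z[OF p] normal_part_rot4[OF p]
    by (simp_all add: u_def[symmetric] K_def L_def n11_def n13_def diff_divide_distrib algebra_simps)
  have h: "h u = (1/2) * ((1 / (E u * - W u - 0\<^sup>2)) * (- W u * - (K u / sqrt (E u)) + E u * - (L u / sqrt (E u))))"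
    using E[OF u] W[OF u] by (simp add: h_def field_simps)
  show ?thesis
    unfolding mean_curvature_vector_def Let_def first second u_def[symmetric] h
    by (simp only: scaleR_scaleR mult_zero_right scaleR_zero_left diff_0_right
        scaleR_left_distrib[symmetric] mult.assoc)
qed

section \<open>Flatness and parallelism\<close>

lemma normal_connection_cong:
  "(\<And>q. q \<in> S \<Longrightarrow> \<xi> q = \<zeta> q) \<Longrightarrow> p \<in> S \<Longrightarrow> normal_connection S z a \<xi> p = normal_connection S z a \<zeta> p"
  unfolding normal_connection_def using dderiv_cong[of S \<xi> \<zeta> p] by simp

lemma orthonormal_normal_frame_\<nu>: "orthonormal_normal_frame S z \<nu>\<^sub>1 \<nu>\<^sub>2"
proof -
  have snd: "smooth_on S (\<lambda>p. snd p)"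
    by (rule S.smooth_on_linear_map[OF bounded_linear_snd])
  have comp: "smooth_on S (\<lambda>p. vector [n11 (fst p), 0, n13 (fst p), 0] $ i)"
    "smooth_on S (\<lambda>p. vector [0, n22 (fst p), 0, n24 (fst p)] $ i)" for i :: 4
    using exhaust_4[of i] smooth_n[THEN smooth_on_S] S.smooth_on_const by auto
  have "smooth_on S \<nu>\<^sub>1"
    unfolding \<nu>\<^sub>1_def[abs_def] by (intro S.smooth_on_rot4 snd comp)
  moreover have "smooth_on S \<nu>\<^sub>2"
    unfolding \<nu>\<^sub>2_def[abs_def] by (intro S.smooth_on_rot4 snd comp)
  ultimately show ?thesis
    by (simp add: orthonormal_normal_frame_def normal_space_frame orthonormal_frame)
qed

text \<open>
  The curvature of the frame in the coordinate directions is \<open>R(\<partial>\<^sub>u, \<partial>\<^sub>v) \<nu>\<^sub>1 = - \<kappa>' \<nu>\<^sub>2\<close>.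
\<close>

lemma \<kappa>_derivative_zero:
  assumes flat: "flat_normal_connection S z" and u: "u \<in> J"
  shows "dderiv J \<kappa> u 1 = 0"
proof -
  define p where "p = (u, 0 :: real)"
  have p: "p \<in> S"
    using u by (simp add: p_def S)
  have \<nu>\<^sub>1: "normal_connection S z a \<nu>\<^sub>1 q = (- \<kappa> (fst q) * snd a) *\<^sub>R \<nu>\<^sub>2 q" if "q \<in> S" for a q
    using normal_connection_frame[OF that has_derivative_const[of 1] has_derivative_const[of 0], of a]
    by simp
  have "normal_connection S z (1, 0) (normal_connection S z (0, 1) \<nu>\<^sub>1) p
      = normal_connection S z (1, 0) (\<lambda>q. 0 *\<^sub>R \<nu>\<^sub>1 q + (- \<kappa> (fst q)) *\<^sub>R \<nu>\<^sub>2 q) p"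
    by (rule normal_connection_cong[OF _ p]) (simp add: \<nu>\<^sub>1)
  also have "\<dots> = - dderiv J \<kappa> u 1 *\<^sub>R \<nu>\<^sub>2 p"
    using normal_connection_frame[OF p has_derivative_const[of 0]
        has_derivative_minus[OF has_derivative_S[OF smooth_has_real_derivative[OF smooth_\<kappa>] p]],
        where a = "(1, 0)"] u
    by (simp add: p_def)
  finally have uv: "normal_connection S z (1, 0) (normal_connection S z (0, 1) \<nu>\<^sub>1) p = - dderiv J \<kappa> u 1 *\<^sub>R \<nu>\<^sub>2 p" .
  have "normal_connection S z (0, 1) (normal_connection S z (1, 0) \<nu>\<^sub>1) p
      = normal_connection S z (0, 1) (\<lambda>q. 0 *\<^sub>R \<nu>\<^sub>1 q + 0 *\<^sub>R \<nu>\<^sub>2 q) p"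
    by (rule normal_connection_cong[OF _ p]) (simp add: \<nu>\<^sub>1)
  also have "\<dots> = 0"
    using normal_connection_frame[OF p has_derivative_const[of 0] has_derivative_const[of 0], where a = "(0, 1)"]
    by simp
  finally have tensor: "E42_inner (normal_curvature_tensor S z (1, 0) (0, 1) \<nu>\<^sub>1 p) (\<nu>\<^sub>2 p) = - dderiv J \<kappa> u 1"
    by (simp add: normal_curvature_tensor_def uv E42_inner_simps orthonormal_frame[OF p])
  let ?x = "dderiv S z p (1, 0)" and ?y = "dderiv S z p (0, 1)"
  have inner: "E42_inner ?x ?y = 0" "E42_inner ?x ?x = E u" "E42_inner ?y ?y = - W u"
    unfolding dderiv_z[OF p] E42_inner_rot4
    by (simp_all add: E42_inner_def p_def E_def W_def power2_eq_square algebra_simps)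
  have "?x \<noteq> ?y" "independent {?x, ?y}"
    using independent_orthogonal_pair[of ?x ?y] E[OF u] W[OF u] unfolding inner by auto
  then have "normal_connection_curvature S z (1, 0) (0, 1) \<nu>\<^sub>1 \<nu>\<^sub>2 p = 0"
    using flat orthonormal_normal_frame_\<nu> p unfolding flat_normal_connection_def by blast
  then show ?thesis
    using E[OF u] W[OF u] unfolding normal_connection_curvature_def tensor first_form_def inner by simp
qed

text \<open>
  Since \<open>\<kappa>\<close> is the only connection coefficient and belongs to the closed form \<open>dv\<close>, a constant
  \<open>\<kappa>\<close> leaves only the commutator of second derivatives of the components of a normal field.
\<close>

lemma normal_curvature_tensor_zero:
  assumes \<kappa>: "\<And>u. u \<in> J \<Longrightarrow> \<kappa> u = c" and \<xi>: "smooth_on S \<xi>" "\<And>q. q \<in> S \<Longrightarrow> \<xi> q \<in> normal_space S z q"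
    and p: "p \<in> S"
  shows "normal_curvature_tensor S z a b \<xi> p = 0"
proof -
  have \<kappa>S: "\<kappa> (fst q) = c" if "q \<in> S" for q
    using that \<kappa> by (auto simp: S)
  have \<nu>: "smooth_on S \<nu>\<^sub>1" "smooth_on S \<nu>\<^sub>2"
    using orthonormal_normal_frame_\<nu> by (auto simp: orthonormal_normal_frame_def)
  define x where "x q = - E42_inner (\<xi> q) (\<nu>\<^sub>1 q)" for q
  define y where "y q = E42_inner (\<xi> q) (\<nu>\<^sub>2 q)" for q
  have x: "smooth_on S x" and y: "smooth_on S y"
    unfolding x_def y_def by (intro S.smooth_on_minus S.smooth_on_E42_inner \<xi> \<nu>)+
  have \<xi>_eq: "\<xi> q = x q *\<^sub>R \<nu>\<^sub>1 q + y q *\<^sub>R \<nu>\<^sub>2 q" if "q \<in> S" for q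
    using normal_decomposition[OF that \<xi>(2)[OF that]] by (simp add: x_def y_def)
  define X where "X a q = dderiv S x q a - c * snd a * y q" for a q
  define Y where "Y a q = dderiv S y q a - c * snd a * x q" for a q
  have first: "normal_connection S z a \<xi> q = X a q *\<^sub>R \<nu>\<^sub>1 q + Y a q *\<^sub>R \<nu>\<^sub>2 q" if "q \<in> S" for a q
    using normal_connection_cong[of \<xi> "\<lambda>q. x q *\<^sub>R \<nu>\<^sub>1 q + y q *\<^sub>R \<nu>\<^sub>2 q" q a, OF \<xi>_eq that]
      normal_connection_frame[OF that smooth_on_has_derivative[OF x that] smooth_on_has_derivative[OF y that], of a]
    by (simp add: X_def Y_def \<kappa>S that)
  have second: "normal_connection S z d (normal_connection S z e \<xi>) p
    = (dderiv S (\<lambda>q. dderiv S x q e) p d - c * snd e * dderiv S y p d - c * snd d * Y e p) *\<^sub>R \<nu>\<^sub>1 p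
      + (dderiv S (\<lambda>q. dderiv S y q e) p d - c * snd e * dderiv S x p d - c * snd d * X e p) *\<^sub>R \<nu>\<^sub>2 p" for d e
  proof -
    have "normal_connection S z d (normal_connection S z e \<xi>) p
        = normal_connection S z d (\<lambda>q. X e q *\<^sub>R \<nu>\<^sub>1 q + Y e q *\<^sub>R \<nu>\<^sub>2 q) p"
      by (rule normal_connection_cong[OF first p])
    moreover have "(X e has_derivative (\<lambda>d. dderiv S (\<lambda>q. dderiv S x q e) p d - c * snd e * dderiv S y p d)) (at p within S)"
      "(Y e has_derivative (\<lambda>d. dderiv S (\<lambda>q. dderiv S y q e) p d - c * snd e * dderiv S x p d)) (at p within S)"
      unfolding X_def[abs_def] Y_def[abs_def]
      by (intro has_derivative_diff has_derivative_mult_right smooth_on_has_derivative[OF _ p] smooth_on_dderiv x y)+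
    note normal_connection_frame[OF p this, of d]
    ultimately show ?thesis
      by (simp add: \<kappa>S p)
  qed
  have commute: "dderiv S (\<lambda>q. dderiv S \<phi> q b) p a = dderiv S (\<lambda>q. dderiv S \<phi> q a) p b"
    if "smooth_on S \<phi>" for \<phi> :: "real \<times> real \<Rightarrow> real"
    using dderiv_commute[of J "{0..<2 * pi}" \<phi> p b a] that p J(1) approachable_J approachable_angles
    unfolding S[symmetric] by (simp add: is_interval_co)
  show ?thesis
    unfolding normal_curvature_tensor_def second commute[OF x] commute[OF y]
    by (simp add: X_def Y_def algebra_simps)
qed

lemma flat_iff_\<kappa>_constant:
  "flat_normal_connection S z \<longleftrightarrow> (\<exists>c. \<forall>u\<in>J. \<kappa> u = c)"
proof
  assume flat: "flat_normal_connection S z"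
  show "\<exists>c. \<forall>u\<in>J. \<kappa> u = c"
  proof (rule has_field_derivative_zero_constant)
    show "convex J"
      using J(1) by (rule is_interval_convex)
    show "(\<kappa> has_real_derivative 0) (at u within J)" if "u \<in> J" for u
      using smooth_has_real_derivative[OF smooth_\<kappa> that] \<kappa>_derivative_zero[OF flat that] by simp
  qed
next
  assume "\<exists>c. \<forall>u\<in>J. \<kappa> u = c"
  then obtain c where "\<And>u. u \<in> J \<Longrightarrow> \<kappa> u = c"
    by blast
  then have "normal_curvature_tensor S z a b n1 p = 0"
    if "p \<in> S" "orthonormal_normal_frame S z n1 n2" for n1 n2 a b p
    using that normal_curvature_tensor_zero[of c n1 p a b] by (auto simp: orthonormal_normal_frame_def)
  then show "flat_normal_connection S z"
    unfolding flat_normal_connection_def normal_connection_curvature_def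
    by (auto simp: E42_inner_simps)
qed

text \<open>Along an orbit, \<open>h \<nu>\<^sub>1\<close> has the covariant derivative \<open>- \<kappa> h \<nu>\<^sub>2\<close>.\<close>

lemma parallel_mean_curvature_imp:
  assumes "parallel_normal_field S z (mean_curvature_vector S z)" and u: "u \<in> J"
  shows "\<kappa> u * h u = 0"
proof -
  define p where "p = (u, 0 :: real)"
  have p: "p \<in> S"
    using u by (simp add: p_def S)
  have "0 = normal_connection S z (0, 1) (mean_curvature_vector S z) p"
    using assms(1) p by (simp add: parallel_normal_field_def)
  also have "\<dots> = normal_connection S z (0, 1) (\<lambda>q. h (fst q) *\<^sub>R \<nu>\<^sub>1 q + 0 *\<^sub>R \<nu>\<^sub>2 q) p"
    by (rule normal_connection_cong[OF _ p]) (simp add: mean_curvature)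
  also have "\<dots> = - (\<kappa> u * h u) *\<^sub>R \<nu>\<^sub>2 p"
    using normal_connection_frame[OF p has_derivative_S[OF smooth_has_real_derivative[OF smooth_h] p]
        has_derivative_const[of 0], where a = "(0, 1)"] u
    by (simp add: p_def)
  finally have "E42_inner (- (\<kappa> u * h u) *\<^sub>R \<nu>\<^sub>2 p) (\<nu>\<^sub>2 p) = 0"
    by (metis E42_inner_zero_left)
  then show ?thesis
    by (simp add: E42_inner_simps orthonormal_frame[OF p])
qed

text \<open>
  The derivative of the quotient \<open>P / (sqrt E sqrt W)\<close> is a positive multiple of
  \<open>N (K W + E L)\<close>, while \<open>h\<close> is a positive multiple of \<open>E L - K W\<close>.  If the quotient is a nonzero
  constant and \<open>h\<close> vanishes, then \<open>N L = 0\<close> everywhere, where \<open>N = 0\<close> means that position and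
  velocity of the meridian are linearly dependent.  At a point with \<open>N \<noteq> 0\<close>, differentiating
  \<open>N L = 0\<close> yields \<open>\<beta>\<^sup>2 = \<alpha>\<^sup>2\<close> or \<open>g' = 0\<close>, and \<open>L\<close> would be nonzero in either case.
  Hence \<open>N\<close> vanishes identically, so \<open>K\<close> and therefore \<open>L\<close> vanish too, and \<open>N = L = 0\<close> is incompatible with the signs of \<open>E\<close> and \<open>W\<close>.
\<close>

lemma \<kappa>_constant_not_minimal:
  assumes \<kappa>: "\<And>u. u \<in> J \<Longrightarrow> \<kappa> u = c" and "c \<noteq> 0"
  shows "\<exists>u\<in>J. h u \<noteq> 0"
proof (rule ccontr)
  assume "\<not> ?thesis"
  then have minimal: "E u * L u = W u * K u" if "u \<in> J" for u
    using that E[OF that] W[OF that] by (auto simp: h_def)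
  define P where "P u = f u * f' u - g u * g' u" for u
  define N where "N u = g u * f' u - f u * g' u" for u
  define C where "C = c / (\<alpha> * \<beta>)"
  have "C \<noteq> 0"
    using \<open>c \<noteq> 0\<close> \<alpha> \<beta> by (simp add: C_def)
  have \<kappa>_P: "P u ^ 2 = C\<^sup>2 * (E u * W u)" "P u \<noteq> 0" if u: "u \<in> J" for u
  proof -
    have "C * (sqrt (E u) * sqrt (W u)) = P u"
      using \<kappa>_eq[OF u] \<kappa>[OF u] \<alpha> \<beta> E[OF u] W[OF u] by (simp add: P_def C_def)
    then show "P u ^ 2 = C\<^sup>2 * (E u * W u)" "P u \<noteq> 0"
      using E[OF u] W[OF u] \<open>C \<noteq> 0\<close> by (auto simp: power_mult_distrib power_divide simp flip: \<open>_ = P u\<close>)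
  qed
  have NL: "N u * L u = 0" if u: "u \<in> J" for u
  proof -
    define P' E' W' where "P' = (f' u)\<^sup>2 + f u * f'' u - (g' u)\<^sup>2 - g u * g'' u"
      "E' = 2 * f' u * f'' u - 2 * g' u * g'' u" "W' = \<beta>\<^sup>2 * (2 * g u * g' u) - \<alpha>\<^sup>2 * (2 * f u * f' u)"
    note d = f'[OF u] g'[OF u] f''[OF u] g''[OF u]
    have "2 * P u * P' = C\<^sup>2 * (E' * W u + E u * W')"
      by (rule derivative_unique_J[OF _ _ \<kappa>_P(1) u])
         (auto simp: P_def E_def W_def P'_E'_W'_def power2_eq_square algebra_simps intro!: derivative_eq_intros d)
    (* Multiplying by E W and substituting P^2 for C^2 E W eliminates the constant. *)
    then have "2 * P u * P' * (E u * W u) = C\<^sup>2 * (E u * W u) * (E' * W u + E u * W')"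
      by simp
    then have "P u * (2 * P' * E u * W u) = P u * (P u * (E' * W u + E u * W'))"
      unfolding \<kappa>_P(1)[OF u, symmetric] by (simp add: power2_eq_square algebra_simps)
    then have "2 * P' * E u * W u = P u * (E' * W u + E u * W')"
      using \<kappa>_P(2)[OF u] by simp
    moreover have "2 * P' * E u * W u - P u * (E' * W u + E u * W') = 2 * N u * (K u * W u + E u * L u)"
      unfolding P'_E'_W'_def P_def E_def W_def N_def K_def L_def by algebra
    ultimately have "N u * (E u * L u) = 0"
      using minimal[OF u] by (simp add: algebra_simps)
    then show ?thesis
      using E[OF u] by simp
  qed
  (* For equal speeds W > 0 means |g| > |f|, whereas N = 0 and E > 0 force |f| > |g|. *)
  have \<alpha>\<beta>: "\<beta>\<^sup>2 \<noteq> \<alpha>\<^sup>2 \<or> N u \<noteq> 0" if u: "u \<in> J" for u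
  proof (rule ccontr)
    assume "\<not> ?thesis"
    then have "\<beta>\<^sup>2 = \<alpha>\<^sup>2" "g u * f' u = f u * g' u"
      by (auto simp: N_def)
    then have "(g u)\<^sup>2 * E u = - ((g' u)\<^sup>2 * ((g u)\<^sup>2 - (f u)\<^sup>2))" "W u = \<alpha>\<^sup>2 * ((g u)\<^sup>2 - (f u)\<^sup>2)"
      unfolding E_def W_def by algebra+
    moreover have "(g u)\<^sup>2 * E u > 0"
      using g_nonzero[OF u] E[OF u] by simp
    ultimately show False
      using W[OF u] \<alpha> by (smt (verit) mult_nonneg_nonneg zero_le_power2 zero_less_mult_iff)
  qed
  note d = f'  g' f'' g''
  have N: "N u = 0" if u: "u \<in> J" for u
  proof (rule ccontr)
    assume "N u \<noteq> 0"
    with NL[OF u] have L: "L u = 0"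
      by simp
    then have K: "K u = 0"
      using minimal[OF u] W[OF u] by simp
    define N' L' where "N' = g u * f'' u - f u * g'' u"
      "L' = \<beta>\<^sup>2 * (g' u * f' u + g u * f'' u) - \<alpha>\<^sup>2 * (f' u * g' u + f u * g'' u)"
    have "N' * L u + N u * L' = 0"
      by (rule derivative_unique_J[OF _ DERIV_const NL u])
         (auto simp: N_def L_def N'_L'_def algebra_simps intro!: derivative_eq_intros d u)
    then have "L' = 0"
      using L \<open>N u \<noteq> 0\<close> by simp
    then have "(\<beta>\<^sup>2 - \<alpha>\<^sup>2) * g' u * (f' u)\<^sup>2 = 0"
      using L K unfolding N'_L'_def L_def K_def by algebra
    then consider "\<beta>\<^sup>2 = \<alpha>\<^sup>2" | "g' u = 0"
      using f'_nonzero[OF u] by auto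
    then show False
    proof cases
      case 1
      then have "L u = \<beta>\<^sup>2 * N u"
        by (simp add: L_def N_def algebra_simps)
      then show False
        using L \<open>N u \<noteq> 0\<close> \<beta> by simp
    next
      case 2
      then show False
        using L f'_nonzero[OF u] g_nonzero[OF u] \<beta> by (simp add: L_def)
    qed
  qed
  obtain u where u: "u \<in> J"
    using J(2) interior_subset by blast
  have "g u * f'' u - f u * g'' u = 0"
    by (rule derivative_unique_J[OF _ DERIV_const N u])
       (auto simp: N_def algebra_simps intro!: derivative_eq_intros d u)
  then have "g u * K u = 0"
    using N[OF u] unfolding N_def K_def by algebra
  then have "L u = 0"
    using minimal[OF u] g_nonzero[OF u] E[OF u] by simp
  then have "(\<beta>\<^sup>2 - \<alpha>\<^sup>2) * (g u * f' u) = 0"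
    using N[OF u] unfolding N_def L_def by algebra
  then show False
    using \<alpha>\<beta>[OF u] N[OF u] g_nonzero[OF u] f'_nonzero[OF u] by simp
qed

text \<open>
  If \<open>\<kappa> = 0\<close> then \<open>f\<^sup>2 - g\<^sup>2\<close> is a constant \<open>k\<close>, which is negative.  So the surface lies in the
  hyperquadric of the vectors with square \<open>k\<close>, \<open>\<nu>\<^sub>1\<close> is radial, and it turns out that the mean
  curvature vector is \<open>- z / k\<close>, that is, the surface is minimal in the hyperquadric.  The
  derivatives of a multiple of \<open>z\<close> are tangential.
\<close>

lemma \<kappa>_zero_parallel:
  assumes \<kappa>: "\<And>u. u \<in> J \<Longrightarrow> \<kappa> u = 0"
  shows "parallel_normal_field S z (mean_curvature_vector S z)"
proof -
  have P: "f u * f' u - g u * g' u = 0" if u: "u \<in> J" for u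
    using \<kappa>[OF u] \<kappa>_eq[OF u] \<alpha> \<beta> E[OF u] W[OF u] by simp
  have "\<exists>k. \<forall>u\<in>J. (f u)\<^sup>2 - (g u)\<^sup>2 = k"
  proof (rule has_field_derivative_zero_constant)
    show "convex J"
      using J(1) by (rule is_interval_convex)
    show "((\<lambda>u. (f u)\<^sup>2 - (g u)\<^sup>2) has_real_derivative 0) (at u within J)" if u: "u \<in> J" for u
      using P[OF u] by (auto intro!: derivative_eq_intros f' g' u simp: mult.commute)
  qed
  then obtain k where k: "\<And>u. u \<in> J \<Longrightarrow> (f u)\<^sup>2 - (g u)\<^sup>2 = k"
    by blast
  have coeff: "h u * n11 u = - (1 / k) * f u" "h u * n13 u = - (1 / k) * g u" if u: "u \<in> J" for u
  proof -
    (* The relation f f' = g g' makes the velocity a multiple of the reflected position (g, f). *)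
    define l where "l = f' u / g u"
    have l: "f' u = l * g u" "g' u = l * f u" "l \<noteq> 0"
      using P[OF u] g_nonzero[OF u] f'_nonzero[OF u] by (auto simp: l_def field_simps)
    have El: "E u = - (l\<^sup>2 * k)"
      unfolding E_def l k[OF u, symmetric] by algebra
    have "k \<noteq> 0"
      using El E[OF u] by auto
    have "(f' u)\<^sup>2 + f u * f'' u - (g' u)\<^sup>2 - g u * g'' u = 0"
      by (rule derivative_unique_J[OF _ DERIV_const P u])
         (auto intro!: derivative_eq_intros f' g' f'' g'' u simp: power2_eq_square)
    then have "K u = - l * E u"
      unfolding K_def E_def l by algebra
    moreover have "L u = l * W u"
      by (simp add: L_def W_def l power2_eq_square algebra_simps)
    ultimately have hl: "h u = l * (1 / sqrt (E u))"
      using E[OF u] W[OF u] by (simp add: h_def field_simps)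
    have "h u * n11 u = l * g' u / E u" "h u * n13 u = l * f' u / E u"
      unfolding n11_def n13_def hl using E[OF u] by simp_all
    then show "h u * n11 u = - (1 / k) * f u" "h u * n13 u = - (1 / k) * g u"
      using \<open>k \<noteq> 0\<close> l(3) unfolding El l by (simp_all add: field_simps power2_eq_square)
  qed
  have H: "mean_curvature_vector S z q = (- (1 / k)) *\<^sub>R z q" if q: "q \<in> S" for q
  proof -
    have u: "fst q \<in> J"
      using q by (auto simp: S)
    show ?thesis
      unfolding mean_curvature[OF q] \<nu>\<^sub>1_def z_eq rot4_scaleR[symmetric]
      by (rule arg_cong[where f = "rot4 \<alpha> \<beta> (snd q)"]) (simp add: vec4_eq_iff coeff[OF u])
  qed
  show ?thesis
    unfolding parallel_normal_field_def
  proof (intro ballI allI)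
    fix p a assume p: "p \<in> S"
    have "dderiv S (mean_curvature_vector S z) p = dderiv S (\<lambda>q. (- (1 / k)) *\<^sub>R z q) p"
      using H p by (rule dderiv_cong)
    also have "\<dots> = (\<lambda>a. (- (1 / k)) *\<^sub>R dderiv S z p a)"
      using z_has_derivative[OF p] unfolding dderiv_z[OF p]
      by (intro S.dderiv_eqI[OF has_derivative_scaleR_right p])
    finally show "normal_connection S z a (mean_curvature_vector S z) p = 0"
      unfolding normal_connection_def normal_part_eq[OF p]
      by (simp add: E42_inner_simps inner_dderiv_z_frame[OF p])
  qed
qed

section \<open>Meridian curves that are straight lines\<close>

lemma linear_meridian_derivative:
  assumes "\<And>u. u \<in> J \<Longrightarrow> f u = c * g u" and "u \<in> J"
  shows "f' u = c * g' u"
  using derivative_unique_J[OF f'[OF assms(2)] DERIV_cmult[OF g'[OF assms(2)], of c] assms] .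

text \<open>
  For \<open>f = c g\<close> the squares of \<open>g\<close> and \<open>g'\<close> cancel in \<open>\<kappa>\<^sup>2\<close>, which is therefore constant.  Since
  \<open>\<kappa>\<close> is continuous on an interval, it cannot change sign.
\<close>

lemma linear_meridian_\<kappa>:
  assumes c: "\<And>u. u \<in> J \<Longrightarrow> f u = c * g u"
  shows "\<exists>k. k \<noteq> 0 \<and> (\<forall>u\<in>J. \<kappa> u = k)"
proof -
  define k where "k = \<alpha> * \<beta> * sqrt ((c\<^sup>2 - 1) / (\<beta>\<^sup>2 - \<alpha>\<^sup>2 * c\<^sup>2))"
  have two_values: "\<kappa> u \<in> {k, - k}" "k \<noteq> 0" if u: "u \<in> J" for u
  proof -
    note fc = c[OF u] linear_meridian_derivative[OF c u]
    have EW: "E u = (c\<^sup>2 - 1) * (g' u)\<^sup>2" "W u = (\<beta>\<^sup>2 - \<alpha>\<^sup>2 * c\<^sup>2) * (g u)\<^sup>2"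
      by (simp_all add: E_def W_def fc power_mult_distrib algebra_simps)
    have pos: "c\<^sup>2 - 1 > 0" "\<beta>\<^sup>2 - \<alpha>\<^sup>2 * c\<^sup>2 > 0"
      using E[OF u] W[OF u] unfolding EW by (auto simp: zero_less_mult_iff)
    have nz: "g' u \<noteq> 0" "g u \<noteq> 0"
      using E[OF u] W[OF u] unfolding EW by auto
    show "k \<noteq> 0"
      using pos \<alpha> \<beta> by (simp add: k_def)
    have "f u * f' u - g u * g' u = (c\<^sup>2 - 1) * (g u * g' u)"
      by (simp add: fc power2_eq_square algebra_simps)
    then have "(\<kappa> u)\<^sup>2 = (\<alpha> * \<beta>)\<^sup>2 * (((c\<^sup>2 - 1) * (g u * g' u))\<^sup>2 / (E u * W u))"
      using E[OF u] W[OF u] by (simp add: \<kappa>_eq[OF u] power_mult_distrib power_divide)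
    also have "\<dots> = (\<alpha> * \<beta>)\<^sup>2 * ((c\<^sup>2 - 1) / (\<beta>\<^sup>2 - \<alpha>\<^sup>2 * c\<^sup>2))"
      unfolding EW using pos nz by (simp add: power_mult_distrib power2_eq_square[of "_ - 1"])
    also have "\<dots> = k\<^sup>2"
      using pos by (simp add: k_def power_mult_distrib)
    finally show "\<kappa> u \<in> {k, - k}"
      by (simp add: power2_eq_iff)
  qed
  have "\<kappa> constant_on J"
  proof (rule continuous_finite_range_constant)
    show "connected J" "continuous_on J \<kappa>"
      using J(1) smooth_\<kappa> by (auto intro: is_interval_connected smooth_on_continuous)
    show "finite (\<kappa> ` J)"
      by (rule finite_subset[of _ "{k, - k}"]) (use two_values(1) in auto)
  qed
  then obtain k' where k': "\<forall>u\<in>J. \<kappa> u = k'"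
    by (auto simp: constant_on_def)
  obtain u where "u \<in> J"
    using J(2) interior_subset by blast
  then have "k' \<noteq> 0"
    using k' two_values[of u] by auto
  with k' show ?thesis
    by blast
qed

text \<open>
  The tangent plane is spanned by the direction of the ruling and the derivative of this
  direction, and both depend on \<open>v\<close> only.
\<close>

lemma linear_meridian_tangent_space:
  assumes c: "\<And>u. u \<in> J \<Longrightarrow> f u = c * g u" and p: "p \<in> S"
  shows "tangent_space S z p
    = range (\<lambda>a. rot4 \<alpha> \<beta> (snd p) (vector [c * fst a, \<alpha> * c * snd a, fst a, \<beta> * snd a]))" (is "_ = range ?T")
proof -
  have u: "fst p \<in> J"
    using p by (auto simp: S)
  note fc = c[OF u] linear_meridian_derivative[OF c u]
  have nz: "g' (fst p) \<noteq> 0" "g (fst p) \<noteq> 0"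
    using f'_nonzero[OF u] g_nonzero[OF u] fc by auto
  have dz: "dderiv S z p a = ?T (fst a * g' (fst p), snd a * g (fst p))" for a
    unfolding dderiv_z[OF p] by (rule arg_cong[where f = "rot4 \<alpha> \<beta> (snd p)"]) (simp add: fc vec4_eq_iff)
  show ?thesis
  proof
    show "tangent_space S z p \<subseteq> range ?T"
      unfolding tangent_space_def
    proof (rule image_subsetI)
      show "dderiv S z p a \<in> range ?T" for a
        unfolding dz[of a] by (rule rangeI)
    qed
    show "range ?T \<subseteq> tangent_space S z p"
    proof (rule image_subsetI)
      fix a
      have "?T a = dderiv S z p (fst a / g' (fst p), snd a / g (fst p))"
        unfolding dz using nz by simp
      then show "?T a \<in> tangent_space S z p"
        by (simp add: tangent_space_def)
    qed
  qed
qed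

text \<open>
  The meridian is part of a straight line through the origin, so the rotations carry it to
  pieces of straight lines, on which \<open>v\<close> is constant and \<open>g\<close> is an affine parameter.
\<close>

lemma linear_meridian_developable:
  assumes c: "\<And>u. u \<in> J \<Longrightarrow> f u = c * g u"
  shows "developable_ruled_surface S z"
proof -
  let ?K = "{0..<2 * pi}"
  interpret K: approachable ?K
    by (rule approachable_angles)
  have J_ne: "J \<noteq> {}"
    using J(2) interior_subset by blast
  have K: "snd ` S = ?K"
    using J_ne by (simp add: S)
  have inj_g: "inj_on g J"
  proof (rule linorder_inj_onI')
    fix a b assume ab: "a \<in> J" "b \<in> J" "a < b"
    then have sub: "{a..b} \<subseteq> J"
      using J(1) by (metis closed_segment_eq_real_ivl closed_segment_subset is_interval_convex less_imp_le)
    have "\<exists>t\<in>{a..b}. g b - g a = g' t * (b - a)"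
    proof (rule mvt_very_simple[of a b g "\<lambda>t h. g' t * h"])
      show "(g has_derivative (*) (g' t)) (at t within {a..b})" if "a \<le> t" "t \<le> b" for t
        using that sub by (intro has_derivative_subset[OF g'[unfolded has_field_derivative_def] sub]) auto
    qed (use ab in auto)
    then obtain t where t: "t \<in> {a..b}" "g b - g a = g' t * (b - a)"
      by blast
    have "g' t \<noteq> 0"
      using f'_nonzero[of t] linear_meridian_derivative[OF c, of t] t(1) sub by auto
    then show "g a \<noteq> g b"
      using t(2) ab(3) by auto
  qed
  have fibre: "(\<lambda>p. g (fst p)) ` {p \<in> S. snd p = v} = g ` J" if "v \<in> ?K" for v
    using that by (force simp: S)
  have "connected (g ` J)"
    using J(1) smooth_on_continuous[OF g] by (intro connected_continuous_image is_interval_connected)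
  then have interval: "is_interval (g ` J)"
    by (simp add: is_interval_connected_1)
  obtain a where a: "a \<in> J"
    using J_ne by blast
  obtain b where b: "b \<in> J" "b \<noteq> a"
    using J.approach[OF a, of 1 1] by auto
  have "g a \<noteq> g b"
    using inj_g a b by (auto dest: inj_onD)
  then have "interior (closed_segment (g a) (g b)) \<noteq> {}"
    by (auto simp: closed_segment_eq_real_ivl)
  moreover have "closed_segment (g a) (g b) \<subseteq> g ` J"
    using interval a b(1) by (intro closed_segment_subset is_interval_convex) auto
  ultimately have interior: "interior (g ` J) \<noteq> {}"
    using interior_mono by blast
  define r where "r v = rot4 \<alpha> \<beta> v (vector [c, 0, 1, 0])" for v
  have "ruling S z snd"
    unfolding ruling_def K
  proof (rule conjI, goal_cases)
    case 2
    show ?case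
    proof (rule exI[of _ "\<lambda>p. g (fst p)"], rule exI[of _ "\<lambda>_. 0"], rule exI[of _ r], intro conjI ballI)
      show "smooth_on S (\<lambda>p. g (fst p))"
        by (rule smooth_on_S[OF g])
      show "smooth_on ?K (\<lambda>_. 0 :: real^4)"
        by (rule K.smooth_on_const)
      show "smooth_on ?K r"
        unfolding r_def[abs_def]
        by (intro K.smooth_on_rot4 K.smooth_on_const K.smooth_on_linear_map bounded_linear_ident)
      show "inj_on (\<lambda>p. (g (fst p), snd p)) S"
        using inj_g by (auto simp: inj_on_def S)
      show "z p = 0 + g (fst p) *\<^sub>R r (snd p)" if "p \<in> S" for p
        using that c by (auto simp: S z_eq r_def rot4_def vec4_eq_iff algebra_simps)
      fix v assume v: "v \<in> ?K"
      have "E42_inner (r v) (r v) = c\<^sup>2 - 1"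
        by (simp add: r_def) (simp add: E42_inner_def power2_eq_square)
      moreover have "c\<^sup>2 - 1 \<noteq> 0"
        using E[OF a] c[OF a] linear_meridian_derivative[OF c a]
        by (auto simp: E_def power_mult_distrib)
      ultimately show "r v \<noteq> 0"
        by (auto simp: E42_inner_simps)
      show "is_interval ((\<lambda>p. g (fst p)) ` {p \<in> S. snd p = v})"
        "interior ((\<lambda>p. g (fst p)) ` {p \<in> S. snd p = v}) \<noteq> {}"
        unfolding fibre[OF v] by (rule interval, rule interior)
    qed
  qed (rule S.smooth_on_linear_map[OF bounded_linear_snd])
  moreover have "normal_space S z p = normal_space S z q" if "p \<in> S" "q \<in> S" "snd p = snd q" for p q
  proof -
    have "tangent_space S z p = tangent_space S z q"
      using linear_meridian_tangent_space[of c p] linear_meridian_tangent_space[of c q] c that by simp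
    then show ?thesis
      by (simp add: normal_space_def)
  qed
  ultimately show ?thesis
    unfolding developable_ruled_surface_def by blast
qed

lemma flat_nonparallel_iff:
  "flat_normal_connection S z \<and> \<not> parallel_normal_field S z (mean_curvature_vector S z)
    \<longleftrightarrow> (\<exists>c. c \<noteq> 0 \<and> (\<forall>u\<in>J. \<kappa> u = c))"
proof -
  have "\<not> parallel_normal_field S z (mean_curvature_vector S z)" if "c \<noteq> 0" "\<forall>u\<in>J. \<kappa> u = c" for c
    using \<kappa>_constant_not_minimal[of c] parallel_mean_curvature_imp that by fastforce
  moreover have "parallel_normal_field S z (mean_curvature_vector S z)" if "\<forall>u\<in>J. \<kappa> u = 0"
    using \<kappa>_zero_parallel that by blast
  ultimately show ?thesis
    unfolding flat_iff_\<kappa>_constant by metis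
qed

lemma \<kappa>_constant_iff:
  "(\<exists>c. c \<noteq> 0 \<and> (\<forall>u\<in>J. \<kappa> u = c)) \<longleftrightarrow>
    (\<exists>C. C \<noteq> 0 \<and> (\<forall>u\<in>J. (f u * f' u - g u * g' u) / (sqrt (E u) * sqrt (W u)) = C))"
proof -
  have \<alpha>\<beta>: "\<alpha> * \<beta> \<noteq> 0"
    using \<alpha> \<beta> by simp
  have "\<kappa> u = \<alpha> * \<beta> * C \<longleftrightarrow> (f u * f' u - g u * g' u) / (sqrt (E u) * sqrt (W u)) = C" if "u \<in> J" for u C
    unfolding \<kappa>_eq[OF that] using \<alpha>\<beta> by (simp only: mult_cancel_left) simp
  then have "(\<forall>u\<in>J. \<kappa> u = \<alpha> * \<beta> * C) \<longleftrightarrow> (\<forall>u\<in>J. (f u * f' u - g u * g' u) / (sqrt (E u) * sqrt (W u)) = C)" for C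
    by simp
  moreover have "(\<exists>c. c \<noteq> 0 \<and> P c) \<longleftrightarrow> (\<exists>C. C \<noteq> 0 \<and> P (\<alpha> * \<beta> * C))" for P
    using \<alpha>\<beta> by (metis mult_eq_0_iff nonzero_mult_div_cancel_left times_divide_eq_right)
  from this[of "\<lambda>c. \<forall>u\<in>J. \<kappa> u = c"] calculation show ?thesis
    by simp
qed

end

theorem theorem7p1:
  fixes \<alpha> \<beta> :: real and J :: "real set" and f g f' g' :: "real \<Rightarrow> real"
    and S :: "(real \<times> real) set" and z :: "real \<times> real \<Rightarrow> real^4"
  assumes "\<alpha> > 0" and "\<beta> > 0"
    and "is_interval J" and "interior J \<noteq> {}"
    and "smooth_on J f" and "smooth_on J g"
    and "\<And>u. u \<in> J \<Longrightarrow> (f has_real_derivative f' u) (at u within J)"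
    and "\<And>u. u \<in> J \<Longrightarrow> (g has_real_derivative g' u) (at u within J)"
    and "\<And>u. u \<in> J \<Longrightarrow> \<alpha>\<^sup>2 * (f u)\<^sup>2 - \<beta>\<^sup>2 * (g u)\<^sup>2 < 0"
    and "\<And>u. u \<in> J \<Longrightarrow> (f' u)\<^sup>2 - (g' u)\<^sup>2 > 0"
    and S_def: "S = J \<times> {0..<2 * pi}"
    and z_def: "z = rotational_surface \<alpha> \<beta> f g"
  shows "(flat_normal_connection S z \<and> \<not> parallel_normal_field S z (mean_curvature_vector S z)
     \<longleftrightarrow> (\<exists>c. 1 < c\<^sup>2 \<and> c\<^sup>2 < \<beta>\<^sup>2 / \<alpha>\<^sup>2 \<and> \<alpha> < \<beta> \<and> (\<forall>u\<in>J. f u = c * g u)) \<or>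
         (\<exists>C. C \<noteq> 0 \<and> (\<forall>u\<in>J. (f u * f' u - g u * g' u) /
            (sqrt ((f' u)\<^sup>2 - (g' u)\<^sup>2) * sqrt (\<beta>\<^sup>2 * (g u)\<^sup>2 - \<alpha>\<^sup>2 * (f u)\<^sup>2)) = C)))
     \<and> (\<forall>c. 1 < c\<^sup>2 \<and> c\<^sup>2 < \<beta>\<^sup>2 / \<alpha>\<^sup>2 \<and> \<alpha> < \<beta> \<and> (\<forall>u\<in>J. f u = c * g u)
          \<longrightarrow> developable_ruled_surface S z)"
proof -
  interpret elliptic_rotational_surface \<alpha> \<beta> J f g f' g' S z
    by standard (use assms in auto)
  have "\<exists>c. c \<noteq> 0 \<and> (\<forall>u\<in>J. \<kappa> u = c)" if "\<forall>u\<in>J. f u = c * g u" for c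
    using linear_meridian_\<kappa> that by blast
  moreover have "developable_ruled_surface S z" if "\<forall>u\<in>J. f u = c * g u" for c
    using linear_meridian_developable that by blast
  ultimately show ?thesis
    using flat_nonparallel_iff \<kappa>_constant_iff unfolding E_def W_def by blast
qed

end
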